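(* Suppose that (i) $M:=\sum_{t=0}^\infty\big(\sup_{i\in\mathcal S,u\in U}|f(t,i,u)|+\delta(t)\big)<\infty$; (ii) $$\Theta:=\sup_{t\in\mathbb N_0,\,i\in\mathcal S}\ \sup_{u_1,u_2\in U,\,u_1\ne u_2}\Big\{\frac{|f(t,i,u_1)-f(t,i,u_2)|}{|u_1-u_2|}+\frac{|p^{u_1}_i-p^{u_2}_i|}{|u_1-u_2|}\Big\}<\infty;$$ and (iii) $U$ satisfies the uniform cone condition. Then there exists a relaxed equilibrium for $J$, i.e. there is $\pi\in\Pi$ such that $J^{\pi'\otimes_1\pi}(i)\le J^\pi(i)$ for all $\pi'\in\Pi$ and all $i\in\mathcal S$.
   Context: Setting (discrete time). $\mathbb N_0=\mathbb N\cup\{0\}$. Fix $\ell,d\in\mathbb N$; $U\subset\mathbb R^\ell$ is compact with Lebesgue measure $\mathrm{Leb}(U)>0$; $\mathcal S=\{1,\dots,d\}$. For each $u\in U$, $p^u=(p^u_{ij})_{i,j\in\mathcal S}$ is a stochastic matrix and $p^u_i\in\mathbb R^d$ is its $i$-th row. $\mathcal P(U)$ is the set of Borel probability measures on $U$. A relaxed feedback control is a map $\pi:\mathcal S\to\mathcal P(U)$; $\Pi$ is the set of all of them. Under $\pi$, $X^\pi=(X^\pi_k)_{k\in\mathbb N_0}$ is the $\mathcal S$-valued Markov chain such that, given $X_t=i$, an action $u$ is sampled from $\pi(i)$ and $X_{t+1}=j$ with probability $p^u_{ij}$ (so its transition probabilities are $\int_U p^u_{ij}\,\pi(i)(du)$).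 $\mathbb E_i$ is expectation given $X_0=i$. The reward is $f:[0,\infty)\times\mathcal S\times U\to\mathbb R$, and $f^\mu(t,i):=\int_U f(t,i,u)\mu(du)$ for $\mu\in\mathcal P(U)$. The discount function $\delta:[0,\infty)\to[0,1]$ is nonincreasing with $\delta(0)=1$. $|\cdot|$ is the Euclidean norm. For $\pi\in\Pi$, $i\in\mathcal S$: $J^\pi(i):=\mathbb E_i\big[\sum_{k=0}^\infty f^{\pi(X^\pi_k)}(k,X^\pi_k)\big]$. For $\pi,\pi'\in\Pi$, $\pi'\otimes_1\pi$ means using $\pi'$ at time $0$ and $\pi$ at all times $\ge1$ (both for sampling actions and in the reward terms); $J^{\pi'\otimes_1\pi}$ is the corresponding value. Uniform cone condition: if $\ell>1$, there are $\vartheta>0$ and $\iota\in(0,\pi/2]$ such that for every $u\in U$ there is a cone with vertex $u$ and angle $\iota$, $\mathrm{cone}(u,\iota)$, with $\mathrm{cone}(u,\iota)\cap B_\vartheta(u)\subseteq U$; if $\ell=1$, there is $\vartheta>0$ such that for every $u\in U$ either $[u-\vartheta,u]\subseteq U$ or $[u,u+\vartheta]\subseteq U$. Here a cone with vertex $u$ and angle $\iota$ is any rotation about $u$ of $u+\Delta_\iota$, where $\Delta_\iota=\{v\in\mathbb R^\ell: v_\ell\ge0,\ v_1^2+\dots+v_{\ell-1}^2\le\tan^2(\iota)v_\ell^2\}$ (the half-space $v_\ell\ge0$ if $\iota=\pi/2$), and $B_\vartheta(u)$ is the ball of radius $\vartheta$ about $u$. *)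

theory Defs
  imports "HOL-Probability.Probability"
begin

text \<open>
  Conventions. The control space \<open>U\<close> is a subset of \<^typ>\<open>real ^ 'l\<close> (so the dimension of the
  control space is \<open>CARD('l)\<close>), the state space is an arbitrary nonempty finite type \<^typ>\<open>'s\<close>
  (so the number of states is \<open>CARD('s)\<close>), \<open>p u $ i $ j\<close> is the probability of moving from
  \<open>i\<close> to \<open>j\<close> under the action \<open>u\<close>, and \<open>p u $ i\<close> is the corresponding row vector. Only the values
  \<open>p u\<close> for \<open>u \<in> U\<close> and \<open>f t i u\<close> for \<open>t \<ge> 0\<close>, \<open>u \<in> U\<close> are relevant.
\<close>


subsection \<open>Uniform cone condition\<close>

text \<open>
  The axis of the reference cone is an arbitrary coordinate \<open>m\<close>; as cones are only considered up to
  rotation (and only in dimension at least two), the choice of \<open>m\<close> is immaterial. The half-space has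
  to be treated separately, because \<open>tan (pi / 2) = 0\<close> in HOL.
\<close>

definition ref_cone :: "'l \<Rightarrow> real \<Rightarrow> (real ^ 'l::finite) set" where
  "ref_cone m \<iota> =
     (if \<iota> = pi / 2 then {v. 0 \<le> v $ m}
      else {v. 0 \<le> v $ m \<and> (\<Sum>k\<in>UNIV - {m}. (v $ k)\<^sup>2) \<le> (tan \<iota>)\<^sup>2 * (v $ m)\<^sup>2})"

definition is_cone :: "(real ^ 'l::finite) set \<Rightarrow> real ^ 'l \<Rightarrow> real \<Rightarrow> bool" where
  "is_cone C u \<iota> \<longleftrightarrow>
     (\<exists>m R. rotation_matrix R \<and> C = (\<lambda>v. u + R *v v) ` ref_cone m \<iota>)"

text \<open>In dimension one, \<open>cbox (u - vec \<theta>) u\<close> is the interval \<open>[u - \<theta>, u]\<close>.\<close>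

definition uniform_cone_condition :: "(real ^ 'l::finite) set \<Rightarrow> bool" where
  "uniform_cone_condition U \<longleftrightarrow>
     (if CARD('l) = 1
      then \<exists>\<theta>>0. \<forall>u\<in>U. cbox (u - vec \<theta>) u \<subseteq> U \<or> cbox u (u + vec \<theta>) \<subseteq> U
      else \<exists>\<theta>>0. \<exists>\<iota>\<in>{0<..pi / 2}. \<forall>u\<in>U. \<exists>C. is_cone C u \<iota> \<and> C \<inter> ball u \<theta> \<subseteq> U)"


subsection \<open>Controlled Markov chains\<close>

definition stochastic_matrix :: "real ^ 's ^ 's::finite \<Rightarrow> bool" where
  "stochastic_matrix A \<longleftrightarrow> (\<forall>i j. 0 \<le> A $ i $ j) \<and> (\<forall>i. (\<Sum>j\<in>UNIV. A $ i $ j) = 1)"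

definition relaxed_controls :: "(real ^ 'l::finite) set \<Rightarrow> ('s \<Rightarrow> (real ^ 'l) measure) set" where
  "relaxed_controls U = {\<pi>. \<forall>i. \<pi> i \<in> space (prob_algebra (restrict_space borel U))}"

text \<open>
  The law, on the space of paths \<^typ>\<open>nat \<Rightarrow> 's\<close>, of the (time-inhomogeneous) Markov chain started
  in \<open>i\<close> whose step from time \<open>n\<close> to time \<open>n + 1\<close> is distributed according to \<open>q n\<close>. It is the
  projective limit provided by the Ionescu-Tulcea theorem.
\<close>

definition chain_kernel :: "(nat \<Rightarrow> 's \<Rightarrow> 's pmf) \<Rightarrow> 's \<Rightarrow> nat \<Rightarrow> (nat \<Rightarrow> 's) \<Rightarrow> 's measure" where
  "chain_kernel q i n x =
     measure_pmf (case n of 0 \<Rightarrow> return_pmf i | Suc k \<Rightarrow> q k (x k))"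

definition chain_law :: "(nat \<Rightarrow> 's \<Rightarrow> 's pmf) \<Rightarrow> 's \<Rightarrow> (nat \<Rightarrow> 's) measure" where
  "chain_law q i =
     projective_family.lim UNIV
       (Ionescu_Tulcea.CI (chain_kernel q i) (\<lambda>_. count_space UNIV)) (\<lambda>_. count_space UNIV)"

definition transition :: "(real ^ 'l \<Rightarrow> real ^ 's ^ 's) \<Rightarrow> (real ^ 'l::finite) measure \<Rightarrow>
    's \<Rightarrow> 's::finite pmf" where
  "transition p \<mu> i = embed_pmf (\<lambda>j. LINT u|\<mu>. p u $ i $ j)"

definition mean_reward :: "(real \<Rightarrow> 's \<Rightarrow> real ^ 'l \<Rightarrow> real) \<Rightarrow> (real ^ 'l::finite) measure \<Rightarrow>
    real \<Rightarrow> 's \<Rightarrow> real" where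
  "mean_reward f \<mu> t i = (LINT u|\<mu>. f t i u)"

text \<open>
  The value of a time-dependent control \<open>\<alpha>\<close>, which uses the relaxed control \<open>\<alpha> k\<close> at time \<open>k\<close>.
\<close>

definition control_value :: "(real ^ 'l \<Rightarrow> real ^ 's ^ 's) \<Rightarrow> (real \<Rightarrow> 's \<Rightarrow> real ^ 'l \<Rightarrow> real) \<Rightarrow>
    (nat \<Rightarrow> 's \<Rightarrow> (real ^ 'l::finite) measure) \<Rightarrow> 's::finite \<Rightarrow> real" where
  "control_value p f \<alpha> i =
     (LINT x|chain_law (\<lambda>k j. transition p (\<alpha> k j) j) i.
        (\<Sum>k. mean_reward f (\<alpha> k (x k)) (real k) (x k)))"

definition concat1 :: "('s \<Rightarrow> 'm) \<Rightarrow> ('s \<Rightarrow> 'm) \<Rightarrow> nat \<Rightarrow> 's \<Rightarrow> 'm"  (infixr \<open>\<otimes>\<^sub>1\<close> 65) where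
  "(\<pi>' \<otimes>\<^sub>1 \<pi>) k = (if k = 0 then \<pi>' else \<pi>)"

definition relaxed_equilibrium :: "(real ^ 'l::finite) set \<Rightarrow> (real ^ 'l \<Rightarrow> real ^ 's ^ 's) \<Rightarrow>
    (real \<Rightarrow> 's \<Rightarrow> real ^ 'l \<Rightarrow> real) \<Rightarrow> ('s::finite \<Rightarrow> (real ^ 'l) measure) \<Rightarrow> bool" where
  "relaxed_equilibrium U p f \<pi> \<longleftrightarrow>
     \<pi> \<in> relaxed_controls U \<and>
     (\<forall>\<pi>'\<in>relaxed_controls U. \<forall>i.
        control_value p f (\<pi>' \<otimes>\<^sub>1 \<pi>) i \<le> control_value p f (\<lambda>_. \<pi>) i)"


subsection \<open>The path law is the law of the intended Markov chain\<close>

lemma Ionescu_Tulcea_chain: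
  fixes q :: "nat \<Rightarrow> 's::finite \<Rightarrow> 's pmf"
  shows "Ionescu_Tulcea (chain_kernel q i) (\<lambda>_. count_space UNIV)"
proof
  fix n
  show "chain_kernel q i n \<in>
      measurable (PiM {0..<n} (\<lambda>_. count_space UNIV)) (subprob_algebra (count_space UNIV))"
  proof (cases n)
    case 0
    have "measure_pmf (return_pmf i) \<in> space (subprob_algebra (count_space UNIV))"
      by (simp add: space_subprob_algebra prob_space_measure_pmf prob_space_imp_subprob_space)
    then show ?thesis
      unfolding chain_kernel_def 0 by simp
  next
    case (Suc k)
    have "(\<lambda>x. x k) \<in> measurable (PiM {0..<n} (\<lambda>_. count_space UNIV)) (count_space (UNIV :: 's set))"
      using Suc by (intro measurable_component_singleton) simp
    moreover have "(\<lambda>j. measure_pmf (q k j)) \<in>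
        measurable (count_space UNIV) (subprob_algebra (count_space UNIV))"
      by (auto simp: space_subprob_algebra prob_space_measure_pmf prob_space_imp_subprob_space)
    ultimately have "(\<lambda>x. measure_pmf (q k (x k))) \<in>
        measurable (PiM {0..<n} (\<lambda>_. count_space UNIV)) (subprob_algebra (count_space UNIV))"
      by (rule measurable_compose)
    then show ?thesis
      using Suc unfolding chain_kernel_def by simp
  qed
qed (auto simp: chain_kernel_def prob_space_measure_pmf)

lemma sets_chain_law [measurable_cong]:
  fixes q :: "nat \<Rightarrow> 's::finite \<Rightarrow> 's pmf"
  shows "sets (chain_law q i) = sets (PiM UNIV (\<lambda>_. count_space UNIV))"
proof -
  interpret Ionescu_Tulcea "chain_kernel q i" "\<lambda>_. count_space UNIV"
    by (rule Ionescu_Tulcea_chain)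
  show ?thesis
    unfolding chain_law_def by simp
qed

lemma space_chain_law [simp]:
  fixes q :: "nat \<Rightarrow> 's::finite \<Rightarrow> 's pmf"
  shows "space (chain_law q i) = UNIV"
  using sets_eq_imp_space_eq[OF sets_chain_law[of q i]] by (simp add: space_PiM)

lemma emeasure_chain_law_cylinder:
  fixes q :: "nat \<Rightarrow> 's::finite \<Rightarrow> 's pmf"
  shows "emeasure (chain_law q i) {x. \<forall>k\<le>n. x k = a k} =
    (if a 0 = i then \<Prod>k<n. ennreal (pmf (q k (a k)) (a (Suc k))) else 0)"
proof -
  let ?M = "\<lambda>_::nat. count_space (UNIV :: 's set)"
  interpret Ionescu_Tulcea "chain_kernel q i" ?M
    by (rule Ionescu_Tulcea_chain)
  define A where "A n = PiE {0..<n} (\<lambda>k. {a k})" for n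
  have A[measurable]: "A n \<in> sets (PiM {0..<n} ?M)" for n
    unfolding A_def by (intro sets_PiM_I_finite) auto
  have step: "emeasure (C 0 (Suc n) (\<lambda>_. undefined)) (A (Suc n)) =
      emeasure (C 0 n (\<lambda>_. undefined)) (A n) * 
      emeasure (chain_kernel q i n (restrict a {0..<n})) {a n}" for n
  proof -
    have und: "(\<lambda>_. undefined) \<in> space (PiM {0..<0} ?M)"
      by (simp add: space_PiM)
    have eP: "emeasure (eP n x) (A (Suc n)) =
        indicator (A n) x * emeasure (chain_kernel q i n (restrict a {0..<n})) {a n}"
      if x: "x \<in> space (PiM {0..<n} ?M)" for x
    proof -
      have ext: "x \<in> extensional {0..<n}"
        using x by (simp add: space_PiM PiE_def)
      have "emeasure (eP n x) (A (Suc n)) =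
          emeasure (chain_kernel q i n x) ((\<lambda>y. x(n := y)) -` A (Suc n) \<inter> UNIV)"
        using emeasure_eP[OF x A[of "Suc n"]] by simp
      also have "(\<lambda>y. x(n := y)) -` A (Suc n) \<inter> UNIV = (if x \<in> A n then {a n} else {})"
        using ext by (auto simp: A_def PiE_iff extensional_def atLeastLessThanSuc)
      finally have *: "emeasure (eP n x) (A (Suc n)) =
          emeasure (chain_kernel q i n x) (if x \<in> A n then {a n} else {})" .
      have "x = restrict a {0..<n}" if "x \<in> A n"
        using that by (auto simp: A_def PiE_iff extensional_def fun_eq_iff restrict_def)
      then show ?thesis
        unfolding * by (cases "x \<in> A n") auto
    qed
    have "emeasure (C 0 (Suc n) (\<lambda>_. undefined)) (A (Suc n)) =
        (\<integral>\<^sup>+x. emeasure (eP n x) (A (Suc n)) \<partial>C 0 n (\<lambda>_. undefined))"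
      using measurable_eP[of n] prob_space_C[OF und, of n] und
      by (simp, subst emeasure_bind[where N = "PiM {0..<Suc n} ?M"])
         (auto simp: space_C measurable_cong_sets[OF sets_C[OF und] refl] prob_space.not_empty)
    also have "\<dots> = (\<integral>\<^sup>+x. indicator (A n) x *
        emeasure (chain_kernel q i n (restrict a {0..<n})) {a n} \<partial>C 0 n (\<lambda>_. undefined))"
      using und by (intro nn_integral_cong eP) (simp add: space_C)
    also have "\<dots> = emeasure (C 0 n (\<lambda>_. undefined)) (A n) *
        emeasure (chain_kernel q i n (restrict a {0..<n})) {a n}"
      using A[of n] und by (subst nn_integral_multc) (auto simp: sets_C intro!: borel_measurable_indicator)
    finally show ?thesis .
  qed
  have C0: "emeasure (C 0 0 (\<lambda>_. undefined)) (A 0) = 1"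
    using A[of 0] by (simp add: A_def)
  have main: "emeasure (C 0 (Suc n) (\<lambda>_. undefined)) (A (Suc n)) =
    (if a 0 = i then \<Prod>k<n. ennreal (pmf (q k (a k)) (a (Suc k))) else 0)" for n
  proof (induction n)
    case 0
    show ?case
      unfolding step[of 0] C0 by (simp add: chain_kernel_def emeasure_pmf_single)
  next
    case (Suc n)
    show ?case
      unfolding step[of "Suc n"] Suc by (simp add: chain_kernel_def emeasure_pmf_single)
  qed
  have "{x. \<forall>k\<le>n. x k = a k} = prod_emb UNIV ?M {0..<Suc n} (A (Suc n))"
    by (auto simp: A_def prod_emb_def PiE_iff space_PiM less_Suc_eq_le)
  then have "emeasure (chain_law q i) {x. \<forall>k\<le>n. x k = a k} = emeasure (CI {0..<Suc n}) (A (Suc n))"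
    unfolding chain_law_def using lim[of "{0..<Suc n}" "A (Suc n)"] A by simp
  also have "\<dots> = emeasure (C 0 (Suc n) (\<lambda>_. undefined)) (A (Suc n))"
    using emeasure_CI[of "{0..<Suc n}" "Suc n" "A (Suc n)"] A
    by (simp add: sets.sets_into_space prod_emb_id A_def space_PiM PiE_mono)
  finally show ?thesis
    using main by simp
qed

lemma pmf_transition:
  fixes p :: "real ^ 'l::finite \<Rightarrow> real ^ 's ^ 's::finite"
  assumes \<mu>: "\<mu> \<in> space (prob_algebra (restrict_space borel U))"
    and p: "\<And>u. u \<in> U \<Longrightarrow> stochastic_matrix (p u)"
    and cont: "\<And>i j. continuous_on U (\<lambda>u. p u $ i $ j)"
  shows "pmf (transition p \<mu> i) j = (LINT u|\<mu>. p u $ i $ j)"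
proof -
  from \<mu> have sets: "sets \<mu> = sets (restrict_space borel U)" and "prob_space \<mu>"
    by (simp_all add: space_prob_algebra)
  interpret prob_space \<mu> by fact
  have space: "space \<mu> = U"
    using sets_eq_imp_space_eq[OF sets] by (simp add: space_restrict_space)
  have bounds: "0 \<le> p u $ i $ j" "p u $ i $ j \<le> 1" "(\<Sum>j\<in>UNIV. p u $ i $ j) = 1"
    if "u \<in> U" for u j
  proof -
    show nn: "0 \<le> p u $ i $ j" and s: "(\<Sum>j\<in>UNIV. p u $ i $ j) = 1" for j
      using p[OF that] by (auto simp: stochastic_matrix_def)
    show "p u $ i $ j \<le> 1"
      using member_le_sum[of j UNIV "\<lambda>j. p u $ i $ j"] nn s by simp
  qed
  have int: "integrable \<mu> (\<lambda>u. p u $ i $ j)" for j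
  proof (rule integrable_const_bound[where B = 1])
    show "AE u in \<mu>. norm (p u $ i $ j) \<le> 1"
      using bounds by (intro AE_I2) (simp add: space)
    show "(\<lambda>u. p u $ i $ j) \<in> borel_measurable \<mu>"
      using borel_measurable_continuous_on_restrict[OF cont]
      by (simp add: measurable_cong_sets[OF sets refl])
  qed
  have nn: "0 \<le> (LINT u|\<mu>. p u $ i $ j)" for j
    using bounds by (intro integral_nonneg_AE AE_I2) (simp add: space)
  have "(\<Sum>j\<in>UNIV. LINT u|\<mu>. p u $ i $ j) = (LINT u|\<mu>. (\<Sum>j\<in>UNIV. p u $ i $ j))"
    using int by simp
  also have "\<dots> = (LINT u|\<mu>. 1)"
    using bounds by (intro Bochner_Integration.integral_cong) (auto simp: space)
  finally have one: "(\<Sum>j\<in>UNIV. LINT u|\<mu>. p u $ i $ j) = 1"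
    by (simp add: prob_space)
  show ?thesis
    unfolding transition_def
    using nn one by (intro pmf_embed_pmf) (auto simp: nn_integral_count_space_finite sum_ennreal)
qed

end

theory Submission
  imports Defs
begin

text \<open>
  If every \<open>\<pi> i\<close> maximises the mean over \<open>\<pi> i\<close> of
  \<open>Q i u = f 0 i u + (\<Sum>j\<in>UNIV. p u $ i $ j * V j)\<close>, where \<open>V\<close> is the value of using \<open>\<pi>\<close> from time \<open>1\<close> on,
  then \<open>\<pi>\<close> is an equilibrium. If only the first \<open>n\<close> members of a dense sequence of actions are
  available, a control supported on \<open>\<epsilon>\<close>-maximisers that is consistent with its own continuation values
  \<open>V\<close> exists by Brouwer's theorem, applied to \<open>V\<close>. Since \<open>U\<close> is compact, these controls have a weak limit
  along a subsequence as \<open>n\<close> tends to infinity and \<open>\<epsilon>\<close> to zero. The continuation values depend on a control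
  only through countably many integrals of continuous functions and are dominated by a convergent
  series, so they converge as well, and optimality passes to the limit, first for the actions of the
  dense sequence and then, by continuity, for all of \<open>U\<close>.
\<close>


section \<open>Weak compactness of the probability measures on a compact set\<close>

text \<open>At the first index \<open>m\<close> where the digits differ, the codes differ by
  \<open>(1/3)^m\<close>, and all later digits together can undo at most half of this. Base 3 leaves
  this gap; in base 2 the tail could cancel it completely.\<close>

lemma ternary_code_agree:
  fixes a b :: "nat \<Rightarrow> bool"
  assumes close: "\<bar>(\<Sum>n. of_bool (a n) * (1/3)^n) - (\<Sum>n. of_bool (b n) * (1/3)^n)\<bar> < (1/3::real)^N / 2"
    and "n < N"
  shows "a n = b n"
proof (rule ccontr)
  assume "a n \<noteq> b n"
  define m where "m = (LEAST k. a k \<noteq> b k)"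
  have m: "a m \<noteq> b m"
    unfolding m_def using \<open>a n \<noteq> b n\<close> by (rule LeastI)
  have below: "a k = b k" if "k < m" for k
    using not_less_Least[OF that[unfolded m_def]] by simp
  have "m \<le> n"
    unfolding m_def using \<open>a n \<noteq> b n\<close> by (rule Least_le)
  define c :: "nat \<Rightarrow> real" where "c k = (of_bool (a k) - of_bool (b k)) * (1/3)^k" for k
  have geo: "summable (\<lambda>k. (1/3::real)^k)"
    by (intro summable_geometric) simp
  have sum_code: "summable (\<lambda>k. of_bool (x k) * (1/3::real)^k)" for x :: "nat \<Rightarrow> bool"
    by (rule summable_comparison_test'[OF geo, of 0]) auto
  have c_le: "\<bar>c k\<bar> \<le> (1/3)^k" for k
    by (auto simp: c_def)
  have c: "summable c"
    by (rule summable_comparison_test'[OF geo, of 0]) (use c_le in auto)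
  have "(\<Sum>n. of_bool (a n) * (1/3::real)^n) - (\<Sum>n. of_bool (b n) * (1/3)^n) = suminf c"
    by (simp add: suminf_diff[OF sum_code sum_code] c_def[abs_def] left_diff_distrib)
  also have "\<dots> = (\<Sum>k. c (k + Suc m)) + (\<Sum>k<Suc m. c k)"
    by (rule suminf_split_initial_segment[OF c])
  also have "(\<Sum>k<Suc m. c k) = c m"
    using below by (simp add: c_def)
  finally have split: "\<bar>(\<Sum>k. c (k + Suc m)) + c m\<bar> < (1/3)^N / 2"
    using close by simp
  have cm: "\<bar>c m\<bar> = (1/3)^m"
    using m by (auto simp: c_def)
  have geo': "(\<lambda>k. (1/3::real)^(k + Suc m)) sums ((1/3)^Suc m * (1 / (1 - 1/3)))"
    using sums_mult[OF geometric_sums[of "1/3::real"], of "(1/3)^Suc m"]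
    by (simp add: power_add mult_ac)
  have "norm (\<Sum>k. c (k + Suc m)) \<le> (\<Sum>k. (1/3)^(k + Suc m))"
    using c_le sums_summable[OF geo'] by (intro norm_suminf_le) (simp_all only: real_norm_def)
  also have "\<dots> = (1/3)^m / 2"
    using geo' by (simp add: sums_iff)
  finally have "(1/3)^m / 2 < (1/3::real)^N / 2"
    using split cm unfolding real_norm_def by linarith
  moreover have "(1/3::real)^N \<le> (1/3)^m"
    using \<open>m \<le> n\<close> \<open>n < N\<close> by (intro power_decreasing) auto
  ultimately show False by simp
qed

text \<open>
  The ternary digits of \<open>s u\<close> record which members of a countable basis contain \<open>u\<close>. By compactness,
  finitely many of them already determine \<open>u\<close> up to a given error, so the inverse of \<open>s\<close> is uniformly
  continuous on \<open>s ` U\<close>, although \<open>s\<close> itself is not continuous.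
\<close>

lemma compact_real_code:
  fixes U :: "'a::{metric_space, second_countable_topology} set"
  assumes "compact U"
  obtains s :: "'a \<Rightarrow> real" where "s \<in> borel_measurable borel" "\<And>u. s u \<in> {0..3/2}"
    "\<And>e. e > 0 \<Longrightarrow> \<exists>d>0. \<forall>u\<in>U. \<forall>v\<in>U. \<bar>s u - s v\<bar> < d \<longrightarrow> dist u v < e"
proof -
  obtain \<B> :: "'a set set" where "countable \<B>" and basis: "topological_basis \<B>"
    using ex_countable_basis by blast
  then have "\<B> \<noteq> {}"
    by (metis UNIV_I empty_iff open_UNIV topological_basisE)
  define B where "B = from_nat_into \<B>"
  have range_B: "range B = \<B>"
    unfolding B_def using \<open>countable \<B>\<close> \<open>\<B> \<noteq> {}\<close> by simp
  have B_meas[measurable]: "B n \<in> sets borel" for n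
    using topological_basis_open[OF basis] range_B by auto
  define s :: "'a \<Rightarrow> real" where "s u = (\<Sum>n. of_bool (u \<in> B n) * (1/3)^n)" for u
  have geo: "(\<lambda>k. (1/3::real)^k) sums (3/2)"
    using geometric_sums[of "1/3::real"] by simp
  show ?thesis
  proof
    show "s \<in> borel_measurable borel"
      unfolding s_def by measurable
    show "s u \<in> {0..3/2}" for u
    proof -
      have "summable (\<lambda>n. of_bool (u \<in> B n) * (1/3::real)^n)"
        by (rule summable_comparison_test'[OF sums_summable[OF geo], of 0]) auto
      then have "0 \<le> s u" "s u \<le> (\<Sum>k. (1/3)^k)"
        unfolding s_def using geo by (auto intro!: suminf_nonneg suminf_le simp: sums_iff)
      then show ?thesis
        using geo by (simp add: sums_iff)
    qed
    show "\<exists>d>0. \<forall>u\<in>U. \<forall>v\<in>U. \<bar>s u - s v\<bar> < d \<longrightarrow> dist u v < e" if "e > 0" for e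
    proof -
      define I where "I = {n. \<exists>x. B n \<subseteq> ball x (e/2)}"
      have "U \<subseteq> (\<Union>n\<in>I. B n)"
      proof
        fix u
        obtain b where "b \<in> \<B>" "u \<in> b" "b \<subseteq> ball u (e/2)"
          using topological_basisE[OF basis open_ball, of u u "e/2"] \<open>e > 0\<close> by auto
        with range_B show "u \<in> (\<Union>n\<in>I. B n)"
          by (auto simp: I_def)
      qed
      moreover have "open (B n)" for n
        using topological_basis_open[OF basis] range_B by auto
      ultimately obtain F where F: "F \<subseteq> I" "finite F" "U \<subseteq> (\<Union>n\<in>F. B n)"
        by (metis compactE_image[OF \<open>compact U\<close>])
      obtain N where N: "\<And>n. n \<in> F \<Longrightarrow> n < N"
        using \<open>finite F\<close> by (auto simp: finite_nat_set_iff_bounded)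
      \<comment> \<open>\<open>N\<close> exceeds every index in \<open>F\<close>, so codes this
        close agree on membership in each \<open>B n\<close> with \<open>n \<in> F\<close>; the one
        that contains \<open>u\<close> also contains \<open>v\<close> and lies in a ball of radius
        \<open>e/2\<close>.\<close>
      have "dist u v < e" if "u \<in> U" "v \<in> U" and sd: "\<bar>s u - s v\<bar> < (1/3)^N / 2" for u v
      proof -
        obtain n where n: "n \<in> F" "u \<in> B n"
          using F \<open>u \<in> U\<close> by auto
        then have "v \<in> B n"
          using ternary_code_agree[OF sd[unfolded s_def] N[OF n(1)]] by simp
        moreover obtain x where "B n \<subseteq> ball x (e/2)"
          using n F by (auto simp: I_def)
        ultimately have "dist x u < e/2" "dist x v < e/2"
          using n(2) by auto
        then show ?thesis
          using dist_triangle_half_r[of x u e v] by simp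
      qed
      then show ?thesis
        by (intro exI[of _ "(1/3)^N / 2"]) auto
    qed
  qed
qed

text \<open>
  Transporting the measures to the real line along the code \<open>s\<close> reduces the claim to Helly's theorem;
  the limit is carried back by the continuous extension of the inverse of \<open>s\<close> to the closure of its
  image.
\<close>

lemma compact_weak_limit:
  fixes U :: "'a::polish_space set"
  assumes "compact U"
    and M: "\<And>n. M n \<in> space (prob_algebra (restrict_space borel U))"
  obtains r \<mu> where "strict_mono (r :: nat \<Rightarrow> nat)" "\<mu> \<in> space (prob_algebra (restrict_space borel U))"
    "\<And>g :: 'a \<Rightarrow> real. continuous_on U g \<Longrightarrow> (\<lambda>n. LINT u|M (r n). g u) \<longlonglongrightarrow> (LINT u|\<mu>. g u)"
proof -
  have M_sets [measurable_cong]: "sets (M n) = sets (restrict_space borel U)" and M_prob: "prob_space (M n)" for n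
    using M[of n] by (simp_all add: space_prob_algebra)
  have M_space: "space (M n) = U" for n
    using sets_eq_imp_space_eq[OF M_sets] by (simp add: space_restrict_space)
  obtain u0 where "u0 \<in> U"
    using prob_space.not_empty[OF M_prob[of 0]] M_space by auto
  obtain s :: "'a \<Rightarrow> real" where s_meas: "s \<in> borel_measurable borel" and s_range: "\<And>u. s u \<in> {0..3/2}"
    and s_code: "\<And>e. e > 0 \<Longrightarrow> \<exists>d>0. \<forall>u\<in>U. \<forall>v\<in>U. \<bar>s u - s v\<bar> < d \<longrightarrow> dist u v < e"
    using compact_real_code[OF \<open>compact U\<close>] by blast
  have s_M [measurable]: "s \<in> borel_measurable (M n)" for n
    using measurable_restrict_space1[OF s_meas] measurable_cong_sets[OF M_sets refl] by blast
  have inj: "inj_on s U"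
  proof (rule inj_onI, rule ccontr)
    fix u v assume "u \<in> U" "v \<in> U" "s u = s v" "u \<noteq> v"
    then obtain d where "d > 0" and d: "\<forall>x\<in>U. \<forall>y\<in>U. \<bar>s x - s y\<bar> < d \<longrightarrow> dist x y < dist u v"
      using s_code[of "dist u v"] by auto
    from d[rule_format, OF \<open>u \<in> U\<close> \<open>v \<in> U\<close>] show False
      using \<open>s u = s v\<close> \<open>d > 0\<close> by simp
  qed
  have "uniformly_continuous_on (s ` U) (inv_into U s)"
    unfolding uniformly_continuous_on_def
  proof (intro allI impI)
    fix e :: real assume "e > 0"
    then obtain d where "d > 0" "\<forall>u\<in>U. \<forall>v\<in>U. \<bar>s u - s v\<bar> < d \<longrightarrow> dist u v < e"
      using s_code by blast
    then show "\<exists>d>0. \<forall>x\<in>s ` U. \<forall>x'\<in>s ` U. dist x' x < d \<longrightarrow> dist (inv_into U s x') (inv_into U s x) < e"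
      by (intro exI[of _ d]) (simp add: inj dist_real_def)
  qed
  then obtain \<phi> where \<phi>_unif: "uniformly_continuous_on (closure (s ` U)) \<phi>"
    and \<phi>_ext: "\<And>x. x \<in> s ` U \<Longrightarrow> inv_into U s x = \<phi> x"
    by (rule uniformly_continuous_on_extension_on_closure) (rule that)
  have \<phi>_s: "\<phi> (s u) = u" if "u \<in> U" for u
    using \<phi>_ext[of "s u"] that inj by simp
  \<comment> \<open>The limit measure may charge limit points of the set of codes; the closure
    \<open>K\<close> captures them, and \<open>\<phi>\<close> still maps it into \<open>U\<close>
    because \<open>U\<close> is closed.\<close>
  define K where "K = closure (s ` U)"
  have "closed K" "K \<noteq> {}" and sK: "u \<in> U \<Longrightarrow> s u \<in> K" for u
    using \<open>u0 \<in> U\<close> closure_subset[of "s ` U"] by (auto simp: K_def)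
  have \<phi>_cont: "continuous_on K \<phi>"
    using uniformly_continuous_imp_continuous[OF \<phi>_unif] by (simp add: K_def)
  have \<phi>_U: "\<phi> x \<in> U" if "x \<in> K" for x
  proof -
    have "\<phi> ` closure (s ` U) \<subseteq> U"
      using \<phi>_cont \<phi>_s compact_imp_closed[OF \<open>compact U\<close>] unfolding K_def
      by (intro image_closure_subset) auto
    then show ?thesis
      using that by (auto simp: K_def)
  qed
  define \<nu> where "\<nu> n = distr (M n) borel s" for n
  have \<nu>_real: "real_distribution (\<nu> n)" for n
    unfolding \<nu>_def using prob_space.real_distribution_distr[OF M_prob s_M] .
  have \<nu>_int: "(LINT x|\<nu> n. h x) = (LINT u|M n. h (s u))" if "continuous_on UNIV h" for h :: "real \<Rightarrow> real" and n
    unfolding \<nu>_def using borel_measurable_continuous_onI[OF that] by (intro integral_distr) auto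
  \<comment> \<open>All codes lie in \<open>{0..3/2}\<close>, so the single interval from -1 to 2
    carries every \<open>\<nu> n\<close>, whatever \<open>e\<close> is; being open on the left, it
    has to start below 0.\<close>
  have "tight \<nu>"
    unfolding tight_def
  proof (intro conjI allI impI \<nu>_real)
    have "-1 < s u \<and> s u \<le> 2" for u
      using s_range[of u] by simp
    then have "s -` {-1<..2} \<inter> space (M n) = space (M n)" for n
      by auto
    then have one: "measure (\<nu> n) {-1<..2} = 1" for n
      unfolding \<nu>_def by (simp add: measure_distr prob_space.prob_space[OF M_prob])
    fix e :: real assume "e > 0"
    then show "\<exists>a b. a < b \<and> (\<forall>n. 1 - e < measure (\<nu> n) {a<..b})"
      by (intro exI[of _ "-1"] exI[of _ 2]) (simp add: one)
  qed
  then obtain r N where r: "strict_mono (r :: nat \<Rightarrow> nat)" and N: "real_distribution N"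
    and weak: "weak_conv_m (\<nu> \<circ> r) N"
    using tight_imp_convergent_subsubsequence[OF \<open>tight \<nu>\<close> strict_mono_id] by auto
  interpret N: real_distribution N by fact
  have lim: "(\<lambda>n. LINT u|M (r n). h (s u)) \<longlonglongrightarrow> (LINT x|N. h x)"
    if "continuous_on UNIV h" "\<And>x. norm (h x) \<le> B" for h :: "real \<Rightarrow> real" and B
    using weak_conv_imp_integral_bdd_continuous_conv[OF _ N weak, of h B] that \<nu>_real \<nu>_int[OF that(1)]
    by (simp add: continuous_on_eq_continuous_at)
  \<comment> \<open>This bounded continuous test function vanishes exactly on \<open>K\<close>, in
    particular at all codes; its integrals are 0 along the sequence, hence in the limit, which
    forces \<open>N\<close> onto \<open>K\<close>.\<close>
  have "(LINT x|N. min 1 (infdist x K)) = 0"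
  proof (rule LIMSEQ_unique[OF lim[of _ 1]])
    show "(\<lambda>n. LINT u|M (r n). min 1 (infdist (s u) K)) \<longlonglongrightarrow> 0"
    proof -
      have "(LINT u|M n. min 1 (infdist (s u) K)) = (LINT u|M n. 0)" for n
        using sK by (intro Bochner_Integration.integral_cong) (auto simp: M_space)
      then show ?thesis by simp
    qed
  qed (auto intro!: continuous_intros simp: infdist_nonneg)
  moreover have "(\<lambda>x. min 1 (infdist x K)) \<in> borel_measurable borel"
    by (intro borel_measurable_continuous_onI continuous_intros)
  then have "integrable N (\<lambda>x. min 1 (infdist x K))"
    by (intro N.integrable_const_bound[where B = 1]) (auto simp: infdist_nonneg)
  ultimately have "AE x in N. min 1 (infdist x K) = 0"
    by (subst (asm) integral_nonneg_eq_0_iff_AE) (auto simp: infdist_nonneg)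
  then have AE_K: "AE x in N. x \<in> K"
    by eventually_elim (use \<open>closed K\<close> \<open>K \<noteq> {}\<close> in \<open>auto simp: in_closed_iff_infdist_zero min_def split: if_splits\<close>)
  \<comment> \<open>On the null set outside \<open>K\<close> the decoding map takes the default
    value \<open>u0\<close>, so that it maps everywhere into \<open>U\<close>.\<close>
  define \<psi> where "\<psi> x = (if x \<in> K then \<phi> x else u0)" for x
  have \<psi>_meas [measurable]: "\<psi> \<in> measurable N (restrict_space borel U)"
  proof (rule measurable_restrict_space2)
    show "\<psi> \<in> borel_measurable N"
      unfolding \<psi>_def using \<phi>_cont \<open>closed K\<close>
      by (subst measurable_cong_sets[OF N.events_eq_borel refl]) (intro borel_measurable_continuous_on_if; simp)
  qed (use \<phi>_U \<open>u0 \<in> U\<close> in \<open>auto simp: \<psi>_def\<close>)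
  show ?thesis
  proof
    show "strict_mono r" by fact
    show "distr N (restrict_space borel U) \<psi> \<in> space (prob_algebra (restrict_space borel U))"
      using N.prob_space_distr[OF \<psi>_meas] by (simp add: space_prob_algebra)
    fix g :: "'a \<Rightarrow> real" assume g: "continuous_on U g"
    obtain B where "B \<ge> 0" and B: "\<And>u. u \<in> U \<Longrightarrow> norm (g u) \<le> B"
      using compact_imp_bounded[OF compact_continuous_image[OF g \<open>compact U\<close>]]
      by (metis bounded_pos image_eqI less_eq_real_def)
    have "continuous_on K (g \<circ> \<phi>)"
      using \<phi>_U by (intro continuous_on_compose \<phi>_cont continuous_on_subset[OF g]) auto
    \<comment> \<open>Weak convergence tests functions on the whole line, so
      \<open>g \<circ> \<phi>\<close> is extended from \<open>K\<close> with the same bound by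
      Tietze's theorem.\<close>
    then obtain h where h: "continuous_on UNIV h" "\<And>x. x \<in> K \<Longrightarrow> h x = (g \<circ> \<phi>) x" "\<And>x. norm (h x) \<le> B"
      using Tietze[of K "g \<circ> \<phi>" UNIV B] \<open>closed K\<close> \<open>B \<ge> 0\<close> B \<phi>_U by auto
    have "(LINT u|M n. h (s u)) = (LINT u|M n. g u)" for n
      using h(2)[OF sK] \<phi>_s by (intro Bochner_Integration.integral_cong) (auto simp: M_space)
    moreover have "(LINT x|N. h x) = (LINT u|distr N (restrict_space borel U) \<psi>. g u)"
    proof (subst integral_distr[OF \<psi>_meas])
      show g': "g \<in> borel_measurable (restrict_space borel U)"
        using borel_measurable_continuous_on_restrict[OF g] .
      show "(LINT x|N. h x) = (LINT x|N. g (\<psi> x))"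
        using AE_K borel_measurable_continuous_onI[OF h(1)] measurable_compose[OF \<psi>_meas g']
        by (intro integral_cong_AE) (auto simp: \<psi>_def h(2) elim: eventually_mono)
    qed
    ultimately show "(\<lambda>n. LINT u|M (r n). g u) \<longlonglongrightarrow> (LINT u|distr N (restrict_space borel U) \<psi>. g u)"
      using lim[OF h(1,3)] by simp
  qed
qed

text \<open>Subsequences are extracted one index at a time; limits already obtained survive every
  further thinning.\<close>

lemma compact_weak_limit_finite:
  fixes U :: "'a::polish_space set"
  assumes "compact U" "finite I"
    and M: "\<And>n i. i \<in> I \<Longrightarrow> M n i \<in> space (prob_algebra (restrict_space borel U))"
  obtains r \<mu> where "strict_mono (r :: nat \<Rightarrow> nat)"
    "\<And>i. i \<in> I \<Longrightarrow> \<mu> i \<in> space (prob_algebra (restrict_space borel U))"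
    "\<And>(g :: 'a \<Rightarrow> real) i. continuous_on U g \<Longrightarrow> i \<in> I \<Longrightarrow>
      (\<lambda>n. LINT u|M (r n) i. g u) \<longlonglongrightarrow> (LINT u|\<mu> i. g u)"
proof -
  have "\<exists>r \<mu>. strict_mono (r :: nat \<Rightarrow> nat) \<and>
    (\<forall>i\<in>I. \<mu> i \<in> space (prob_algebra (restrict_space borel U)) \<and>
      (\<forall>g :: 'a \<Rightarrow> real. continuous_on U g \<longrightarrow>
        (\<lambda>n. LINT u|M (r n) i. g u) \<longlonglongrightarrow> (LINT u|\<mu> i. g u)))"
    using \<open>finite I\<close> M
  proof (induction I rule: finite_induct)
    case empty
    show ?case by (intro exI[of _ id]) (auto simp: strict_mono_def)
  next
    case (insert i I)
    then obtain r \<mu> where r: "strict_mono (r :: nat \<Rightarrow> nat)"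
      and \<mu>: "\<And>j. j \<in> I \<Longrightarrow> \<mu> j \<in> space (prob_algebra (restrict_space borel U))"
      and lim: "\<And>j g. j \<in> I \<Longrightarrow> continuous_on U (g :: 'a \<Rightarrow> real) \<Longrightarrow>
        (\<lambda>n. LINT u|M (r n) j. g u) \<longlonglongrightarrow> (LINT u|\<mu> j. g u)"
      by (metis insertCI)
    obtain r' \<mu>' where r': "strict_mono (r' :: nat \<Rightarrow> nat)"
      and \<mu>': "\<mu>' \<in> space (prob_algebra (restrict_space borel U))"
      and lim': "\<And>g. continuous_on U (g :: 'a \<Rightarrow> real) \<Longrightarrow>
        (\<lambda>n. LINT u|M (r (r' n)) i. g u) \<longlonglongrightarrow> (LINT u|\<mu>'. g u)"
      using compact_weak_limit[OF \<open>compact U\<close>, of "\<lambda>n. M (r n) i"] insert.prems by (metis insertI1)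
    show ?case
    proof (intro exI[of _ "r \<circ> r'"] exI[of _ "\<mu>(i := \<mu>')"] conjI ballI allI impI)
      show "strict_mono (r \<circ> r')"
        using r r' by (rule strict_mono_o)
      show "(\<mu>(i := \<mu>')) j \<in> space (prob_algebra (restrict_space borel U))" if "j \<in> insert i I" for j
        using that \<mu> \<mu>' by auto
      show "(\<lambda>n. LINT u|M ((r \<circ> r') n) j. g u) \<longlonglongrightarrow> (LINT u|(\<mu>(i := \<mu>')) j. g u)"
        if "j \<in> insert i I" "continuous_on U g" for j and g :: "'a \<Rightarrow> real"
        using that lim' LIMSEQ_subseq_LIMSEQ[OF lim r'] by (auto simp: o_def)
    qed
  qed
  then show ?thesis
    using that by blast
qed


section \<open>Expected rewards along a Markov chain\<close>

lemma measurable_chain_coordinate [measurable]: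
  fixes q :: "nat \<Rightarrow> 's::finite \<Rightarrow> 's pmf"
  shows "(\<lambda>x. x n) \<in> measurable (chain_law q i) (count_space UNIV)"
  by (subst measurable_cong_sets[OF sets_chain_law refl]) (rule measurable_component_singleton, simp)

lemma prob_space_chain_law:
  fixes q :: "nat \<Rightarrow> 's::finite \<Rightarrow> 's pmf"
  shows "prob_space (chain_law q i)"
proof
  have "{x \<in> space (chain_law q i). x 0 = j} \<in> sets (chain_law q i)" for j
    by measurable
  then have ev: "{x. x 0 = j} \<in> sets (chain_law q i)" for j
    by simp
  \<comment> \<open>The cylinder formula at time 0 gives mass 1 to the paths starting in
    \<open>i\<close> and mass 0 to all others.\<close>
  have "emeasure (chain_law q i) (space (chain_law q i)) =
      emeasure (chain_law q i) (\<Union>j. {x. \<forall>k\<le>0. x k = (\<lambda>_. j) k})"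
    by (intro arg_cong[where f = "emeasure _"]) auto
  also have "\<dots> = (\<Sum>j\<in>UNIV. emeasure (chain_law q i) {x. \<forall>k\<le>0. x k = (\<lambda>_. j) k})"
    by (rule sum_emeasure[symmetric]) (use ev in \<open>auto simp: disjoint_family_on_def\<close>)
  also have "\<dots> = (\<Sum>j\<in>UNIV. if j = i then 1 else 0)"
    unfolding emeasure_chain_law_cylinder by simp
  finally show "emeasure (chain_law q i) (space (chain_law q i)) = 1"
    by simp
qed

lemma prob_chain_law_0:
  fixes q :: "nat \<Rightarrow> 's::finite \<Rightarrow> 's pmf"
  shows "measure (chain_law q i) {x. x 0 = j} = of_bool (j = i)"
  using emeasure_chain_law_cylinder[of q i 0 "\<lambda>_. j"] by (simp add: measure_def)

text \<open>The event is cut into cylinders over the paths up to time \<open>n\<close> that end in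
  \<open>j\<close>; prolonging any of them by \<open>k\<close> multiplies its probability by the
  same factor \<open>pmf (q n j) k\<close>.\<close>

lemma prob_chain_law_step:
  fixes q :: "nat \<Rightarrow> 's::finite \<Rightarrow> 's pmf"
  shows "measure (chain_law q i) {x. x n = j \<and> x (Suc n) = k} =
    measure (chain_law q i) {x. x n = j} * pmf (q n j) k"
proof -
  interpret prob_space "chain_law q i"
    by (rule prob_space_chain_law)
  define cyl where "cyl m a = {x. \<forall>l\<le>m. x l = a l}" for m and a :: "nat \<Rightarrow> 's"
  have [measurable]: "cyl m a \<in> events" for m a
  proof -
    have "{x \<in> space (chain_law q i). x l = a l} \<in> events" for l
      by measurable
    then have "{x \<in> space (chain_law q i). \<forall>l\<in>{..m}. x l = a l} \<in> events"
      by (intro sets.sets_Collect_finite_All) auto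
    then show ?thesis by (simp add: cyl_def Ball_def)
  qed
  \<comment> \<open>Extensional functions represent each initial segment exactly once, which makes
    \<open>H\<close> finite and its cylinders disjoint.\<close>
  define H where "H = {a \<in> PiE {..n} (\<lambda>_. UNIV :: 's set). a n = j}"
  have "finite H"
    unfolding H_def by (intro finite_subset[OF _ finite_PiE[of "{..n}" "\<lambda>_. UNIV"]]) auto
  have disj: "disjoint_family_on (cyl n) H"
    unfolding disjoint_family_on_def
  proof (intro ballI impI)
    fix a b assume "a \<in> H" "b \<in> H" "a \<noteq> b"
    then have "\<exists>l\<in>{..n}. a l \<noteq> b l"
      unfolding H_def using PiE_ext by blast
    then show "cyl n a \<inter> cyl n b = {}"
      by (auto simp: cyl_def)
  qed
  have one: "{x. x n = j} = (\<Union>a\<in>H. cyl n a)"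
  proof (intro set_eqI iffI)
    fix x assume "x \<in> {x. x n = j}"
    then have "restrict x {..n} \<in> H" "x \<in> cyl n (restrict x {..n})"
      by (auto simp: H_def cyl_def)
    then show "x \<in> (\<Union>a\<in>H. cyl n a)" by blast
  qed (auto simp: H_def cyl_def)
  have cyl_Suc: "cyl (Suc n) (a(Suc n := k)) = cyl n a \<inter> {x. x (Suc n) = k}" for a
    by (auto simp: cyl_def le_Suc_eq)
  have two: "{x. x n = j \<and> x (Suc n) = k} = (\<Union>a\<in>H. cyl (Suc n) (a(Suc n := k)))"
    unfolding cyl_Suc UN_extend_simps(4)[symmetric] one[symmetric] by auto
  have disj': "disjoint_family_on (\<lambda>a. cyl (Suc n) (a(Suc n := k))) H"
    using disj unfolding disjoint_family_on_def cyl_Suc by blast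
  have step: "prob (cyl (Suc n) (a(Suc n := k))) = prob (cyl n a) * pmf (q n j) k" if "a \<in> H" for a
    using that unfolding cyl_def measure_def emeasure_chain_law_cylinder
    by (auto simp: H_def enn2real_mult)
  show ?thesis
    unfolding two one using disj disj' \<open>finite H\<close>
    by (simp add: finite_measure_finite_Union image_subset_iff step sum_distrib_right)
qed

lemma prob_chain_law_Suc:
  fixes q :: "nat \<Rightarrow> 's::finite \<Rightarrow> 's pmf"
  shows "measure (chain_law q i) {x. x (Suc n) = k} =
    (\<Sum>j\<in>UNIV. measure (chain_law q i) {x. x n = j} * pmf (q n j) k)"
proof -
  interpret prob_space "chain_law q i"
    by (rule prob_space_chain_law)
  have "{x \<in> space (chain_law q i). x n = j \<and> x (Suc n) = k} \<in> events" for j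
    by measurable
  then have "prob (\<Union>j. {x. x n = j \<and> x (Suc n) = k}) = (\<Sum>j\<in>UNIV. prob {x. x n = j \<and> x (Suc n) = k})"
    by (intro finite_measure_finite_Union) (auto simp: disjoint_family_on_def)
  also have "(\<Union>j. {x. x n = j \<and> x (Suc n) = k}) = {x. x (Suc n) = k}"
    by auto
  finally show ?thesis
    by (simp add: prob_chain_law_step)
qed

lemma integral_chain_law_coordinate:
  fixes q :: "nat \<Rightarrow> 's::finite \<Rightarrow> 's pmf" and g :: "'s \<Rightarrow> real"
  shows "(LINT x|chain_law q i. g (x n)) = (\<Sum>j\<in>UNIV. measure (chain_law q i) {x. x n = j} * g j)"
proof -
  interpret prob_space "chain_law q i"
    by (rule prob_space_chain_law)
  have [measurable]: "{x. x n = j} \<in> events" for j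
  proof -
    have "{x \<in> space (chain_law q i). x n = j} \<in> events" by measurable
    then show ?thesis by simp
  qed
  have "(LINT x|chain_law q i. g (x n)) = (LINT x|chain_law q i. (\<Sum>j\<in>UNIV. g j * indicator {x. x n = j} x))"
    by (intro Bochner_Integration.integral_cong) (auto simp: indicator_def of_bool_def if_distrib cong: if_cong)
  also have "\<dots> = (\<Sum>j\<in>UNIV. measure (chain_law q i) {x. x n = j} * g j)"
    by (subst Bochner_Integration.integral_sum) (auto simp: emeasure_eq_measure mult.commute)
  finally show ?thesis .
qed

section \<open>Transition operator and value series\<close>

definition expect_step :: "('s \<Rightarrow> 's \<Rightarrow> real) \<Rightarrow> ('s::finite \<Rightarrow> real) \<Rightarrow> 's \<Rightarrow> real" where
  "expect_step q g i = (\<Sum>j\<in>UNIV. q i j * g j)"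

text \<open>\<open>expect_step q\<close> is the transition operator of a homogeneous chain, so this
  series is an expected total reward. Written without a path measure, its dependence on
  \<open>q\<close> and \<open>r\<close> is accessible to limits.\<close>

definition chain_value :: "('s \<Rightarrow> 's \<Rightarrow> real) \<Rightarrow> (nat \<Rightarrow> 's::finite \<Rightarrow> real) \<Rightarrow> 's \<Rightarrow> real" where
  "chain_value q r i = (\<Sum>k. (expect_step q ^^ k) (r k) i)"

text \<open>Averaging with a stochastic matrix does not increase the sup norm.\<close>

lemma expect_step_iterate_bound:
  assumes q: "\<And>i j. 0 \<le> q i j" "\<And>i. (\<Sum>j\<in>UNIV. q i j) = 1"
    and g: "\<And>i. \<bar>g i\<bar> \<le> b"
  shows "\<bar>(expect_step q ^^ k) g i\<bar> \<le> b"
proof (induction k arbitrary: i)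
  case (Suc k)
  have "\<bar>(expect_step q ^^ Suc k) g i\<bar> \<le> (\<Sum>j\<in>UNIV. \<bar>q i j * (expect_step q ^^ k) g j\<bar>)"
    by (simp add: expect_step_def)
  also have "\<dots> \<le> (\<Sum>j\<in>UNIV. q i j * b)"
    using Suc q by (intro sum_mono) (auto simp: abs_mult intro!: mult_left_mono)
  also have "\<dots> = b"
    using q by (simp flip: sum_distrib_right)
  finally show ?case .
qed (use g in simp)

lemma chain_value_bound:
  assumes q: "\<And>i j. 0 \<le> q i j" "\<And>i. (\<Sum>j\<in>UNIV. q i j) = 1"
    and r: "\<And>k i. \<bar>r k i\<bar> \<le> b k" and b: "summable b"
  shows "\<bar>chain_value q r i\<bar> \<le> suminf b"
  unfolding chain_value_def
  using norm_suminf_le[of "\<lambda>k. (expect_step q ^^ k) (r k) i" b]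
    expect_step_iterate_bound[OF q r] b by simp

lemma tendsto_expect_step_iterate:
  assumes "\<And>i j. ((\<lambda>x. q x i j) \<longlongrightarrow> q' i j) F" "\<And>i. ((\<lambda>x. g x i) \<longlongrightarrow> g' i) F"
  shows "((\<lambda>x. (expect_step (q x) ^^ k) (g x) i) \<longlongrightarrow> (expect_step q' ^^ k) g' i) F"
proof (induction k arbitrary: i)
  case (Suc k)
  show ?case
    using assms(1) Suc by (auto simp: expect_step_def intro!: tendsto_intros)
qed (use assms in simp)

text \<open>Each term is a polynomial in finitely many entries of \<open>q\<close> and
  \<open>r\<close>, hence converges; \<open>b\<close> dominates the series uniformly in
  \<open>x\<close>, so Tannery's theorem exchanges limit and sum.\<close>

lemma tendsto_chain_value:
  assumes lim: "\<And>i j. ((\<lambda>x. q x i j) \<longlongrightarrow> q' i j) F" "\<And>k i. ((\<lambda>x. r x k i) \<longlongrightarrow> r' k i) F"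
    and q: "\<And>x i j. 0 \<le> q x i j" "\<And>x i. (\<Sum>j\<in>UNIV. q x i j) = 1"
    and r: "\<And>x k i. \<bar>r x k i\<bar> \<le> b k" and b: "summable b"
  shows "((\<lambda>x. chain_value (q x) (r x) i) \<longlongrightarrow> chain_value q' r' i) F"
proof (cases "F = bot")
  case False
  have "norm ((expect_step (q x) ^^ k) (r x k) i) \<le> b k" for x k
    using expect_step_iterate_bound[of "q x" "r x k"] q r by simp
  then have "\<forall>\<^sub>F (k, x) in sequentially \<times>\<^sub>F F. norm ((expect_step (q x) ^^ k) (r x k) i) \<le> b k"
    by (intro always_eventually) auto
  note bound = this
  have "((\<lambda>x. (expect_step (q x) ^^ k) (r x k) i) \<longlongrightarrow> (expect_step q' ^^ k) (r' k) i) F" for k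
    by (intro tendsto_expect_step_iterate lim)
  from tannerys_theorem[OF this bound b False] show ?thesis
    by (simp add: chain_value_def)
qed simp

text \<open>Each induction step moves the last transition from the law onto the function, which is
  why \<open>g\<close> varies. The first transition \<open>q 0\<close> stays separate because a
  deviation at time 0 may alter it.\<close>

lemma sum_prob_chain_law_expect_step:
  fixes q :: "nat \<Rightarrow> 's::finite \<Rightarrow> 's pmf"
  assumes hom: "\<And>n. q (Suc n) = q1"
  shows "(\<Sum>j\<in>UNIV. measure (chain_law q i) {x. x (Suc n) = j} * g j) =
    (\<Sum>j\<in>UNIV. pmf (q 0 i) j * (expect_step (\<lambda>l. pmf (q1 l)) ^^ n) g j)"
proof (induction n arbitrary: g)
  case 0
  show ?case
    by (simp add: prob_chain_law_Suc prob_chain_law_0)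
next
  case (Suc n)
  let ?T = "expect_step (\<lambda>l. pmf (q1 l))" and ?P = "\<lambda>j. measure (chain_law q i) {x. x (Suc n) = j}"
  have "(\<Sum>j\<in>UNIV. measure (chain_law q i) {x. x (Suc (Suc n)) = j} * g j) =
      (\<Sum>j\<in>UNIV. \<Sum>l\<in>UNIV. ?P l * pmf (q1 l) j * g j)"
    by (subst prob_chain_law_Suc) (simp add: hom sum_distrib_right)
  also have "\<dots> = (\<Sum>l\<in>UNIV. ?P l * ?T g l)"
    by (subst sum.swap) (simp add: expect_step_def sum_distrib_left mult.assoc)
  also have "\<dots> = (\<Sum>j\<in>UNIV. pmf (q 0 i) j * (?T ^^ n) (?T g) j)"
    by (rule Suc)
  finally show ?case
    by (simp add: funpow_swap1 del: funpow.simps add: funpow_Suc_right)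
qed

text \<open>Domination by \<open>b\<close> exchanges integral and series. After the first step the
  chain is homogeneous, but rewards keep the absolute clock, hence the shift to
  \<open>r (Suc k)\<close>.\<close>

lemma integral_chain_law_suminf:
  fixes q :: "nat \<Rightarrow> 's::finite \<Rightarrow> 's pmf" and r :: "nat \<Rightarrow> 's \<Rightarrow> real"
  assumes hom: "\<And>n. q (Suc n) = q1"
    and r: "\<And>k i. \<bar>r k i\<bar> \<le> b k" and b: "summable b"
  shows "(LINT x|chain_law q i. (\<Sum>k. r k (x k))) =
    r 0 i + (\<Sum>j\<in>UNIV. pmf (q 0 i) j * chain_value (\<lambda>l. pmf (q1 l)) (\<lambda>k. r (Suc k)) j)"
proof -
  interpret prob_space "chain_law q i"
    by (rule prob_space_chain_law)
  let ?T = "expect_step (\<lambda>l. pmf (q1 l))"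
  have int: "integrable (chain_law q i) (\<lambda>x. r k (x k))" for k
    using r by (intro integrable_const_bound[where B = "b k"] AE_I2) auto
  have norm: "(LINT x|chain_law q i. norm (r k (x k))) \<le> b k" for k
    using integral_mono[OF integrable_norm[OF int[of k]], of "\<lambda>_. b k"] r prob_space by simp
  have sum_r: "summable (\<lambda>k. norm (r k (x k)))" for x
    using r by (intro summable_comparison_test'[OF b, of 0]) auto
  have sum_int: "summable (\<lambda>k. LINT x|chain_law q i. norm (r k (x k)))"
    using norm by (intro summable_comparison_test'[OF b, of 0]) auto
  note series = sums_integral[OF int AE_I2[OF sum_r] sum_int]
  \<comment> \<open>Summability for each starting state \<open>j\<close> lets the series over time
    be exchanged with the sum over the states at time 1.\<close>
  have sum_T: "summable (\<lambda>k. (?T ^^ k) (r (Suc k)) j)" for j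
  proof (rule summable_comparison_test'[of "\<lambda>k. b (Suc k)" 0])
    show "norm ((?T ^^ k) (r (Suc k)) j) \<le> b (Suc k)" for k
      using expect_step_iterate_bound[of "\<lambda>l. pmf (q1 l)" "r (Suc k)" "b (Suc k)" k j] r
      by (simp add: sum_pmf_eq_1)
  qed (use b summable_Suc_iff in auto)
  have "(LINT x|chain_law q i. (\<Sum>k. r k (x k))) = (\<Sum>k. LINT x|chain_law q i. r k (x k))"
    using series by (simp add: sums_iff)
  also have "\<dots> = (LINT x|chain_law q i. r 0 (x 0)) + (\<Sum>k. LINT x|chain_law q i. r (Suc k) (x (Suc k)))"
    using suminf_split_head[OF sums_summable[OF series]] by simp
  also have "(LINT x|chain_law q i. r 0 (x 0)) = r 0 i"
    by (simp add: integral_chain_law_coordinate[where g = "r 0"] prob_chain_law_0)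
  also have "(\<Sum>k. LINT x|chain_law q i. r (Suc k) (x (Suc k))) =
      (\<Sum>k. \<Sum>j\<in>UNIV. pmf (q 0 i) j * (?T ^^ k) (r (Suc k)) j)"
    by (simp add: integral_chain_law_coordinate sum_prob_chain_law_expect_step[where ?q1.0 = q1] hom)
  also have "\<dots> = (\<Sum>j\<in>UNIV. pmf (q 0 i) j * (\<Sum>k. (?T ^^ k) (r (Suc k)) j))"
    using sum_T by (subst suminf_sum) (auto intro!: sum.cong suminf_mult summable_mult)
  finally show ?thesis
    by (simp add: chain_value_def)
qed


section \<open>Approximate equilibria for finitely many actions\<close>

lemma continuous_on_Max_image:
  fixes f :: "'a \<Rightarrow> 'b::topological_space \<Rightarrow> 'c::linorder_topology"
  assumes "finite A" "A \<noteq> {}" "\<And>a. a \<in> A \<Longrightarrow> continuous_on S (f a)"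
  shows "continuous_on S (\<lambda>x. Max ((\<lambda>a. f a x) ` A))"
  using assms
proof (induction A rule: finite_ne_induct)
  case (insert a A)
  then have "continuous_on S (\<lambda>x. max (f a x) (Max ((\<lambda>a. f a x) ` A)))"
    by (intro continuous_on_max) auto
  then show ?case
    using insert.hyps by simp
qed simp

text \<open>
  The weights are proportional to \<open>max 0 (Q - Max Q + \<epsilon>)\<close>: they depend continuously on the continuation
  values and charge only \<open>\<epsilon>\<close>-optimal actions. As the continuation values form a vector indexed by the
  states, Brouwer's theorem is needed only in a dimension that does not depend on \<open>A\<close>.
\<close>

lemma finite_action_approx_equilibrium:
  fixes A :: "'a set" and p :: "'a \<Rightarrow> 's::finite \<Rightarrow> 's \<Rightarrow> real" and f :: "nat \<Rightarrow> 's \<Rightarrow> 'a \<Rightarrow> real"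
  assumes A: "finite A" "A \<noteq> {}"
    and p: "\<And>a i j. a \<in> A \<Longrightarrow> 0 \<le> p a i j" "\<And>a i. a \<in> A \<Longrightarrow> (\<Sum>j\<in>UNIV. p a i j) = 1"
    and f: "\<And>k i a. a \<in> A \<Longrightarrow> \<bar>f k i a\<bar> \<le> b k" and b: "summable b"
    and "\<epsilon> > 0"
  obtains \<theta> :: "'s \<Rightarrow> 'a pmf" and V :: "'s \<Rightarrow> real" where "\<And>i. set_pmf (\<theta> i) \<subseteq> A"
    "\<And>i. V i = chain_value (\<lambda>i j. measure_pmf.expectation (\<theta> i) (\<lambda>a. p a i j))
      (\<lambda>k i. measure_pmf.expectation (\<theta> i) (f (Suc k) i)) i"
    "\<And>i a. a \<in> A \<Longrightarrow> f 0 i a + (\<Sum>j\<in>UNIV. p a i j * V j) \<le>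
      measure_pmf.expectation (\<theta> i) (f 0 i) +
      (\<Sum>j\<in>UNIV. measure_pmf.expectation (\<theta> i) (\<lambda>a. p a i j) * V j) + \<epsilon>"
proof -
  \<comment> \<open>The payoff of playing \<open>a\<close> now against continuation values
    \<open>v\<close>; these form a Euclidean vector so that Brouwer's theorem applies.\<close>
  define Q :: "'a \<Rightarrow> 's \<Rightarrow> real ^ 's \<Rightarrow> real" where
    "Q a i v = f 0 i a + (\<Sum>j\<in>UNIV. p a i j * v $ j)" for a i v
  define m where "m i v = Max ((\<lambda>a. Q a i v) ` A)" for i v
  define w where "w i a v = max 0 (Q a i v - m i v + \<epsilon>)" for i a v
  define W where "W i v = (\<Sum>a\<in>A. w i a v)" for i v
  define \<theta> where "\<theta> i a v = w i a v / W i v" for i a v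
  have Q_le: "Q a i v \<le> m i v" if "a \<in> A" for a i v
    unfolding m_def using A that by (intro Max_ge) auto
  \<comment> \<open>A maximiser of \<open>Q\<close> gets weight exactly \<open>\<epsilon>\<close>,
    so the normalising sum never vanishes.\<close>
  have W_pos: "0 < W i v" for i v
  proof -
    have "m i v \<in> (\<lambda>a. Q a i v) ` A"
      unfolding m_def using A by (intro Max_in) auto
    then obtain a where "a \<in> A" "w i a v = \<epsilon>"
      using \<open>\<epsilon> > 0\<close> by (auto simp: w_def)
    moreover from \<open>a \<in> A\<close> have "w i a v \<le> W i v"
      unfolding W_def using A by (intro member_le_sum) (auto simp: w_def)
    ultimately show ?thesis
      using \<open>\<epsilon> > 0\<close> by simp
  qed
  have \<theta>_nonneg: "0 \<le> \<theta> i a v" for i a v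
    using W_pos[of i v] by (simp add: \<theta>_def w_def)
  have \<theta>_sum: "(\<Sum>a\<in>A. \<theta> i a v) = 1" for i v
    using W_pos[of i v] by (simp add: \<theta>_def W_def flip: sum_divide_distrib)
  have Q_cont: "continuous_on UNIV (Q a i)" for a i
    unfolding Q_def by (intro continuous_intros)
  then have w_cont: "continuous_on UNIV (w i a)" for i a
    unfolding w_def m_def using A by (intro continuous_intros continuous_on_max continuous_on_Max_image)
  then have \<theta>_cont: "continuous_on UNIV (\<theta> i a)" for i a
    unfolding \<theta>_def using W_pos unfolding W_def
    by (intro continuous_intros) (auto simp: less_le)
  have \<theta>_lim: "(\<theta> i a \<longlongrightarrow> \<theta> i a v) (at v within S)" for i a v S
    using continuous_on_subset[OF \<theta>_cont subset_UNIV[of "insert v S"], of i a]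
    by (auto simp: continuous_on_def intro: tendsto_within_subset)
  define q where "q v i j = (\<Sum>a\<in>A. \<theta> i a v * p a i j)" for v i j
  define r where "r v k i = (\<Sum>a\<in>A. \<theta> i a v * f k i a)" for v k i
  have q_nonneg: "0 \<le> q v i j" for v i j
    unfolding q_def using \<theta>_nonneg p by (intro sum_nonneg mult_nonneg_nonneg) auto
  have q_sum: "(\<Sum>j\<in>UNIV. q v i j) = 1" for v i
  proof -
    have "(\<Sum>j\<in>UNIV. q v i j) = (\<Sum>a\<in>A. \<theta> i a v * (\<Sum>j\<in>UNIV. p a i j))"
      unfolding q_def by (subst sum.swap) (simp add: sum_distrib_left)
    then show ?thesis
      using p \<theta>_sum by simp
  qed
  have r_bound: "\<bar>r v k i\<bar> \<le> b k" for v k i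
  proof -
    have "\<bar>r v k i\<bar> \<le> (\<Sum>a\<in>A. \<theta> i a v * b k)"
      unfolding r_def using f \<theta>_nonneg
      by (intro order_trans[OF sum_abs] sum_mono) (auto simp: abs_mult intro!: mult_left_mono)
    then show ?thesis
      using \<theta>_sum by (simp flip: sum_distrib_right)
  qed
  \<comment> \<open>\<open>F\<close> sends candidate continuation values to those actually generated
    by the control built from them; a fixed point is the required consistency.\<close>
  define F where "F v = (\<chi> i. chain_value (q v) (\<lambda>k. r v (Suc k)) i)" for v
  \<comment> \<open>\<open>C\<close> bounds every component of \<open>F v\<close>, whatever
    \<open>v\<close> is, so \<open>F\<close> maps the cube \<open>S\<close> into itself.\<close>
  define C where "C = (\<Sum>k. b (Suc k))"
  define S where "S = cbox (- vec C) (vec C :: real ^ 's)"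
  have b': "summable (\<lambda>k. b (Suc k))"
    using b summable_Suc_iff by blast
  have F_bound: "\<bar>F v $ i\<bar> \<le> C" for v i
    unfolding F_def C_def using chain_value_bound[OF q_nonneg q_sum r_bound b'] by simp
  have "continuous_on S F"
    unfolding F_def
  proof (intro continuous_on_vec_lambda)
    fix i
    show "continuous_on S (\<lambda>v. chain_value (q v) (\<lambda>k. r v (Suc k)) i)"
      unfolding continuous_on_def
    proof
      fix v
      show "((\<lambda>v. chain_value (q v) (\<lambda>k. r v (Suc k)) i) \<longlongrightarrow>
          chain_value (q v) (\<lambda>k. r v (Suc k)) i) (at v within S)"
        by (rule tendsto_chain_value[OF _ _ q_nonneg q_sum r_bound b'])
           (unfold q_def r_def, (intro tendsto_intros \<theta>_lim)+)
    qed
  qed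
  \<comment> \<open>Any instance of the bound shows this; it makes the cube nonempty.\<close>
  moreover have "C \<ge> 0"
    using F_bound[of undefined undefined] by linarith
  then have "0 \<in> S"
    by (simp add: S_def mem_box_cart)
  moreover have "F v \<in> S" for v
    using F_bound[of v] by (simp add: S_def mem_box_cart abs_le_iff minus_le_iff)
  ultimately obtain v where "F v = v"
    using brouwer[of S F] by (auto simp: S_def)
  then have v: "v $ i = chain_value (q v) (\<lambda>k. r v (Suc k)) i" for i
    by (metis F_def vec_lambda_beta)
  define P where "P i = embed_pmf (\<lambda>a. if a \<in> A then \<theta> i a v else 0)" for i
  have pmf_P: "pmf (P i) a = (if a \<in> A then \<theta> i a v else 0)" for i a
    unfolding P_def
  proof (rule pmf_embed_pmf)
    have "(\<integral>\<^sup>+a. ennreal (if a \<in> A then \<theta> i a v else 0) \<partial>count_space UNIV) = (\<Sum>a\<in>A. ennreal (\<theta> i a v))"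
      using A by (subst nn_integral_count_space'[of A]) auto
    then show "(\<integral>\<^sup>+a. ennreal (if a \<in> A then \<theta> i a v else 0) \<partial>count_space UNIV) = 1"
      using \<theta>_nonneg \<theta>_sum by (simp add: sum_ennreal)
  qed (use \<theta>_nonneg in auto)
  have supp: "set_pmf (P i) \<subseteq> A" for i
    by (auto simp: set_pmf_iff pmf_P split: if_splits)
  have E: "measure_pmf.expectation (P i) g = (\<Sum>a\<in>A. \<theta> i a v * g a)" for i and g :: "'a \<Rightarrow> real"
    using A supp by (subst integral_measure_pmf_real[of A]) (auto simp: pmf_P mult.commute)
  show thesis
  proof
    show "set_pmf (P i) \<subseteq> A" for i
      by (rule supp)
    show "v $ i = chain_value (\<lambda>i j. measure_pmf.expectation (P i) (\<lambda>a. p a i j))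
      (\<lambda>k i. measure_pmf.expectation (P i) (f (Suc k) i)) i" for i
      using v[of i] by (simp add: E q_def[abs_def] r_def[abs_def])
    fix i a assume "a \<in> A"
    \<comment> \<open>Only actions with \<open>Q\<close> above \<open>m i v - \<epsilon>\<close>
      carry weight, so the mean of \<open>Q\<close> is at least this number, while no action exceeds
      \<open>m i v\<close>.\<close>
    have "(m i v - \<epsilon>) = (\<Sum>a\<in>A. \<theta> i a v * (m i v - \<epsilon>))"
      using \<theta>_sum by (simp flip: sum_distrib_right)
    also have "\<dots> \<le> (\<Sum>a\<in>A. \<theta> i a v * Q a i v)"
    proof (intro sum_mono)
      fix a
      show "\<theta> i a v * (m i v - \<epsilon>) \<le> \<theta> i a v * Q a i v"
      proof (cases "\<theta> i a v = 0")
        case False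
        then have "m i v - \<epsilon> \<le> Q a i v"
          by (auto simp: \<theta>_def w_def max_def split: if_splits)
        then show ?thesis
          using \<theta>_nonneg by (intro mult_left_mono)
      qed simp
    qed
    also have "\<dots> = (\<Sum>a\<in>A. \<theta> i a v * f 0 i a) + (\<Sum>j\<in>UNIV. (\<Sum>a\<in>A. \<theta> i a v * p a i j) * v $ j)"
      unfolding Q_def distrib_left sum.distrib sum_distrib_left sum_distrib_right
      by (subst (2) sum.swap) (simp add: mult.assoc)
    finally show "f 0 i a + (\<Sum>j\<in>UNIV. p a i j * v $ j) \<le>
      measure_pmf.expectation (P i) (f 0 i) +
      (\<Sum>j\<in>UNIV. measure_pmf.expectation (P i) (\<lambda>a. p a i j) * v $ j) + \<epsilon>"
      using Q_le[OF \<open>a \<in> A\<close>, of i v] by (simp add: E Q_def)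
  qed
qed


section \<open>Existence of relaxed equilibria\<close>

lemma abs_integral_le_bound:
  fixes g :: "'a \<Rightarrow> real"
  assumes "prob_space M" and g: "\<And>x. x \<in> space M \<Longrightarrow> \<bar>g x\<bar> \<le> b"
  shows "\<bar>LINT x|M. g x\<bar> \<le> b"
proof -
  interpret prob_space M by fact
  have "norm (LINT x|M. g x) \<le> (LINT x|M. norm (g x))"
    by (rule integral_norm_bound)
  also have "\<dots> \<le> b"
  proof (cases "integrable M (\<lambda>x. norm (g x))")
    case True
    then show ?thesis
      using g by (intro integral_le_const AE_I2) auto
  next
    case False
    \<comment> \<open>Without integrability the integral is 0 by convention, so
      \<open>0 \<le> b\<close> suffices; the bound at any point of the space gives it.\<close>
    obtain x where "x \<in> space M"
      using not_empty by blast
    then have "0 \<le> b"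
      using g[of x] by linarith
    then show ?thesis
      using False by (simp add: not_integrable_integral_eq)
  qed
  finally show ?thesis by simp
qed

lemma space_prob_algebra_restrict_borel:
  assumes "\<mu> \<in> space (prob_algebra (restrict_space borel U))"
  shows "prob_space \<mu>" "space \<mu> = U" "sets \<mu> = sets (restrict_space borel U)"
  using assms sets_eq_imp_space_eq[of \<mu> "restrict_space borel U"]
  by (auto simp: space_prob_algebra space_restrict_space)

lemma integrable_continuous_compact:
  fixes g :: "'a::topological_space \<Rightarrow> real"
  assumes "compact U" and \<mu>: "\<mu> \<in> space (prob_algebra (restrict_space borel U))"
    and g: "continuous_on U g"
  shows "integrable \<mu> g"
proof -
  note \<mu> = space_prob_algebra_restrict_borel[OF \<mu>]
  interpret prob_space \<mu> by (rule \<mu>)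
  obtain B where "\<And>x. x \<in> U \<Longrightarrow> norm (g x) \<le> B"
    using compact_imp_bounded[OF compact_continuous_image[OF g \<open>compact U\<close>]]
    by (metis bounded_iff image_eqI)
  then show ?thesis
    using borel_measurable_continuous_on_restrict[OF g]
    by (intro integrable_const_bound[where B = B] AE_I2)
       (auto simp: \<mu>(2) measurable_cong_sets[OF \<mu>(3) refl])
qed

text \<open>A deviation at time 0 affects only the first reward and the first transition, so the
  value is linear in \<open>\<pi>' i\<close>, with continuation values depending on
  \<open>\<pi>\<close> alone. This reduces the equilibrium inequality to a comparison of single
  actions.\<close>

lemma control_value_concat1:
  fixes p :: "real ^ 'l::finite \<Rightarrow> real ^ 's ^ 's::finite"
  assumes p: "\<And>u. u \<in> U \<Longrightarrow> stochastic_matrix (p u)"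
    and p_cont: "\<And>i j. continuous_on U (\<lambda>u. p u $ i $ j)"
    and f: "\<And>k i u. u \<in> U \<Longrightarrow> \<bar>f (real k) i u\<bar> \<le> b k" and b: "summable b"
    and \<pi>': "\<pi>' \<in> relaxed_controls U" and \<pi>: "\<pi> \<in> relaxed_controls U"
  shows "control_value p f (\<pi>' \<otimes>\<^sub>1 \<pi>) i = (LINT u|\<pi>' i. f 0 i u) +
    (\<Sum>j\<in>UNIV. (LINT u|\<pi>' i. p u $ i $ j) *
      chain_value (\<lambda>i j. LINT u|\<pi> i. p u $ i $ j) (\<lambda>k i. LINT u|\<pi> i. f (real (Suc k)) i u) j)"
proof -
  let ?\<alpha> = "\<pi>' \<otimes>\<^sub>1 \<pi>"
  have \<alpha>: "?\<alpha> k j \<in> space (prob_algebra (restrict_space borel U))" for k j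
    using \<pi> \<pi>' by (simp add: concat1_def relaxed_controls_def)
  note \<alpha>_prob = space_prob_algebra_restrict_borel[OF \<alpha>]
  have r: "\<bar>mean_reward f (?\<alpha> k j) (real k) j\<bar> \<le> b k" for k j
    unfolding mean_reward_def using f by (intro abs_integral_le_bound \<alpha>_prob) (auto simp: \<alpha>_prob)
  have hom: "(\<lambda>j. transition p (?\<alpha> (Suc n) j) j) = (\<lambda>j. transition p (\<pi> j) j)" for n
    by (simp add: concat1_def)
  have pmf_\<alpha>: "pmf (transition p (?\<alpha> k j) j) l = (LINT u|?\<alpha> k j. p u $ j $ l)" for k j l
    by (rule pmf_transition[OF \<alpha> p p_cont])
  have pmf_\<pi>: "(\<lambda>j. pmf (transition p (\<pi> j) j)) = (\<lambda>j l. LINT u|\<pi> j. p u $ j $ l)"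
    using pmf_\<alpha>[of 1] by (simp add: concat1_def fun_eq_iff)
  show ?thesis
    unfolding control_value_def
    using integral_chain_law_suminf[where q = "\<lambda>k j. transition p (?\<alpha> k j) j" and
        ?q1.0 = "\<lambda>j. transition p (\<pi> j) j" and r = "\<lambda>k j. mean_reward f (?\<alpha> k j) (real k) j", OF hom r b]
      pmf_\<alpha>[of 0]
    by (simp add: mean_reward_def concat1_def pmf_\<pi>)
qed

lemma relaxed_equilibrium_exists:
  fixes U :: "(real ^ 'l::finite) set"
    and p :: "real ^ 'l \<Rightarrow> real ^ 's ^ 's::finite"
    and f :: "real \<Rightarrow> 's \<Rightarrow> real ^ 'l \<Rightarrow> real"
  assumes U: "compact U" "U \<noteq> {}"
    and p: "\<And>u. u \<in> U \<Longrightarrow> stochastic_matrix (p u)"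
    and p_cont: "\<And>i j. continuous_on U (\<lambda>u. p u $ i $ j)"
    and f_cont: "\<And>k i. continuous_on U (f (real k) i)"
    and f: "\<And>k i u. u \<in> U \<Longrightarrow> \<bar>f (real k) i u\<bar> \<le> b k" and b: "summable b"
  shows "\<exists>\<pi>. relaxed_equilibrium U p f \<pi>"
proof -
  define PU where "PU = space (prob_algebra (restrict_space borel U))"
  define q where "q \<pi> i j = (LINT u|\<pi> i. p u $ i $ j)" for \<pi> :: "'s \<Rightarrow> (real ^ 'l) measure" and i j
  define r where "r \<pi> k i = (LINT u|\<pi> i. f (real (Suc k)) i u)"
    for \<pi> :: "'s \<Rightarrow> (real ^ 'l) measure" and k i
  have q_prob: "0 \<le> q \<pi> i j" "(\<Sum>j\<in>UNIV. q \<pi> i j) = 1" if "\<And>i. \<pi> i \<in> PU" for \<pi> i j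
  proof -
    have "q \<pi> i j = pmf (transition p (\<pi> i) i) j" for j
      unfolding q_def using that by (intro pmf_transition[symmetric, OF _ p p_cont]) (auto simp: PU_def)
    then show "0 \<le> q \<pi> i j" "(\<Sum>j\<in>UNIV. q \<pi> i j) = 1"
      by (auto simp: sum_pmf_eq_1)
  qed
  have r_bound: "\<bar>r \<pi> k i\<bar> \<le> b (Suc k)" if "\<And>i. \<pi> i \<in> PU" for \<pi> k i
    using space_prob_algebra_restrict_borel[OF that[of i, unfolded PU_def]] f[of _ "Suc k" i]
    unfolding r_def by (intro abs_integral_le_bound) auto
  have b': "summable (\<lambda>k. b (Suc k))"
    using b summable_Suc_iff by blast
  obtain D where D: "countable D" "D \<subseteq> U" "U \<subseteq> closure D"
    by (rule separable)
  then have "D \<noteq> {}"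
    using U by auto
  define a where "a = from_nat_into D"
  have range_a: "range a = D"
    unfolding a_def using D \<open>D \<noteq> {}\<close> by simp
  then have a_U: "a n \<in> U" for n
    using D by auto
  \<comment> \<open>Actions are represented by indices in the dense sequence. At level
    \<open>n\<close> the first \<open>Suc n\<close> of them compete, with tolerance
    \<open>1 / real (Suc n)\<close>.\<close>
  define approx where "approx n \<theta> V \<longleftrightarrow>
      (\<forall>i. V i = chain_value (\<lambda>i j. measure_pmf.expectation (\<theta> i) (\<lambda>m. p (a m) $ i $ j))
        (\<lambda>k i. measure_pmf.expectation (\<theta> i) (\<lambda>m. f (real (Suc k)) i (a m))) i) \<and>
      (\<forall>i. \<forall>m\<le>n. f (real 0) i (a m) + (\<Sum>j\<in>UNIV. p (a m) $ i $ j * V j) \<le>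
        measure_pmf.expectation (\<theta> i) (\<lambda>m. f (real 0) i (a m)) +
        (\<Sum>j\<in>UNIV. measure_pmf.expectation (\<theta> i) (\<lambda>m. p (a m) $ i $ j) * V j) + 1 / real (Suc n))"
    for n and \<theta> :: "'s \<Rightarrow> nat pmf" and V :: "'s \<Rightarrow> real"
  have "\<exists>\<theta> V. approx n \<theta> V" for n
  proof (rule finite_action_approx_equilibrium[of "{..n}" "\<lambda>m i j. p (a m) $ i $ j"
        "\<lambda>k i m. f (real k) i (a m)" b "1 / real (Suc n)"])
    show "0 \<le> p (a m) $ i $ j" "(\<Sum>j\<in>UNIV. p (a m) $ i $ j) = 1" for m i j
      using p[OF a_U] by (auto simp: stochastic_matrix_def)
    show "\<bar>f (real k) i (a m)\<bar> \<le> b k" for k i m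
      by (rule f[OF a_U])
  qed (use b in \<open>auto simp: approx_def simp del: of_nat_Suc of_nat_0\<close>)
  then obtain \<theta> V where approx: "approx n (\<theta> n) (V n)" for n
    by metis
  have a_meas: "a \<in> measurable (measure_pmf P) (restrict_space borel U)" for P
    using a_U by (intro measurable_restrict_space2) auto
  \<comment> \<open>Pushing the index distributions forward along \<open>a\<close> gives measures on
    \<open>U\<close>, to which weak compactness applies.\<close>
  define M where "M n i = distr (measure_pmf (\<theta> n i)) (restrict_space borel U) a" for n i
  have M: "M n i \<in> PU" for n i
    unfolding M_def PU_def using measure_pmf.prob_space_distr[OF a_meas]
    by (simp add: space_prob_algebra)
  have E: "measure_pmf.expectation (\<theta> n i) (\<lambda>m. g (a m)) = (LINT u|M n i. g u)"
    if "continuous_on U g" for g :: "real ^ 'l \<Rightarrow> real" and n i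
    unfolding M_def using borel_measurable_continuous_on_restrict[OF that]
    by (intro integral_distr[symmetric] a_meas)
  obtain \<rho> \<mu> where \<rho>: "strict_mono (\<rho> :: nat \<Rightarrow> nat)" and \<mu>: "\<And>i. \<mu> i \<in> PU"
    and lim: "\<And>g i. continuous_on U (g :: real ^ 'l \<Rightarrow> real) \<Longrightarrow>
      (\<lambda>n. LINT u|M (\<rho> n) i. g u) \<longlonglongrightarrow> (LINT u|\<mu> i. g u)"
    using compact_weak_limit_finite[OF U(1), of UNIV M] M unfolding PU_def by (metis UNIV_I finite)
  define W where "W = chain_value (q \<mu>) (r \<mu>)"
  \<comment> \<open>The value of the limit control, split into first reward and continuation; the
    aim is that no single action exceeds it.\<close>
  define R where "R i = (LINT u|\<mu> i. f 0 i u) + (\<Sum>j\<in>UNIV. q \<mu> i j * W j)" for i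
  have f0_cont: "continuous_on U (f 0 i)" for i
    using f_cont[of 0] by simp
  have q_lim: "(\<lambda>n. q (M (\<rho> n)) i j) \<longlonglongrightarrow> q \<mu> i j" for i j
    unfolding q_def by (intro lim p_cont)
  have V_M: "V n i = chain_value (q (M n)) (r (M n)) i" for n i
    using approx[of n] by (simp only: approx_def q_def[abs_def] r_def[abs_def] E[OF p_cont] E[OF f_cont])
  have opt: "f 0 i (a m) + (\<Sum>j\<in>UNIV. p (a m) $ i $ j * V n j) \<le>
      (LINT u|M n i. f 0 i u) + (\<Sum>j\<in>UNIV. q (M n) i j * V n j) + 1 / real (Suc n)"
    if "m \<le> n" for n i m
    using approx[of n, unfolded approx_def, THEN conjunct2, rule_format, OF that, of i]
    by (simp only: q_def E[OF p_cont] E[OF f0_cont] of_nat_0)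
  have V_lim: "(\<lambda>n. V (\<rho> n) j) \<longlonglongrightarrow> W j" for j
    unfolding V_M W_def
    by (rule tendsto_chain_value[OF q_lim _ q_prob[OF M] r_bound[OF M] b'])
       (unfold r_def, intro lim f_cont)
  \<comment> \<open>For fixed \<open>m\<close> the approximate inequality holds from index
    \<open>m\<close> on, since \<open>\<rho> n \<ge> n\<close>, and both sides converge.\<close>
  have R_dense: "f 0 i (a m) + (\<Sum>j\<in>UNIV. p (a m) $ i $ j * W j) \<le> R i" for i m
  proof (rule LIMSEQ_le)
    show "(\<lambda>n. f 0 i (a m) + (\<Sum>j\<in>UNIV. p (a m) $ i $ j * V (\<rho> n) j)) \<longlonglongrightarrow>
        f 0 i (a m) + (\<Sum>j\<in>UNIV. p (a m) $ i $ j * W j)"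
      by (intro tendsto_intros V_lim)
    have "(\<lambda>n. 1 / real (Suc (\<rho> n))) \<longlonglongrightarrow> 0"
      using LIMSEQ_subseq_LIMSEQ[OF LIMSEQ_inverse_real_of_nat \<rho>]
      by (simp add: o_def inverse_eq_divide)
    then have "(\<lambda>n. (LINT u|M (\<rho> n) i. f 0 i u) + (\<Sum>j\<in>UNIV. q (M (\<rho> n)) i j * V (\<rho> n) j) +
        1 / real (Suc (\<rho> n))) \<longlonglongrightarrow> (LINT u|\<mu> i. f 0 i u) + (\<Sum>j\<in>UNIV. q \<mu> i j * W j) + 0"
      by (intro tendsto_add tendsto_sum tendsto_mult V_lim q_lim lim f0_cont)
    then show "(\<lambda>n. (LINT u|M (\<rho> n) i. f 0 i u) + (\<Sum>j\<in>UNIV. q (M (\<rho> n)) i j * V (\<rho> n) j) +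
        1 / real (Suc (\<rho> n))) \<longlonglongrightarrow> R i"
      by (simp add: R_def)
    have "f 0 i (a m) + (\<Sum>j\<in>UNIV. p (a m) $ i $ j * V (\<rho> n) j) \<le>
        (LINT u|M (\<rho> n) i. f 0 i u) + (\<Sum>j\<in>UNIV. q (M (\<rho> n)) i j * V (\<rho> n) j) +
        1 / real (Suc (\<rho> n))" if "m \<le> n" for n
      using that seq_suble[OF \<rho>, of n] by (intro opt) simp
    then show "\<exists>N. \<forall>n\<ge>N. f 0 i (a m) + (\<Sum>j\<in>UNIV. p (a m) $ i $ j * V (\<rho> n) j) \<le>
        (LINT u|M (\<rho> n) i. f 0 i u) + (\<Sum>j\<in>UNIV. q (M (\<rho> n)) i j * V (\<rho> n) j) +
        1 / real (Suc (\<rho> n))"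
      by blast
  qed
  have Q_cont: "continuous_on U (\<lambda>u. f 0 i u + (\<Sum>j\<in>UNIV. p u $ i $ j * W j))" for i
    by (intro continuous_intros f0_cont p_cont)
  have "closure D \<subseteq> U"
    using D compact_imp_closed[OF U(1)] by (intro closure_minimal)
  \<comment> \<open>The payoff is continuous in the action, so the bound extends from the dense set
    to \<open>U\<close>.\<close>
  have R_U: "f 0 i u + (\<Sum>j\<in>UNIV. p u $ i $ j * W j) \<le> R i" if "u \<in> U" for u i
  proof (rule continuous_le_on_closure[OF continuous_on_subset[OF Q_cont \<open>closure D \<subseteq> U\<close>]])
    show "u \<in> closure D"
      using that D by blast
    show "f 0 i x + (\<Sum>j\<in>UNIV. p x $ i $ j * W j) \<le> R i" if "x \<in> D" for x
      using that R_dense unfolding range_a[symmetric] by blast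
  qed
  have \<mu>': "\<mu> \<in> relaxed_controls U"
    using \<mu> by (simp add: relaxed_controls_def PU_def)
  have value_eq: "control_value p f (\<pi>' \<otimes>\<^sub>1 \<mu>) i = (LINT u|\<pi>' i. f 0 i u) + (\<Sum>j\<in>UNIV. q \<pi>' i j * W j)"
    if "\<pi>' \<in> relaxed_controls U" for \<pi>' i
    unfolding W_def q_def r_def by (rule control_value_concat1[OF p p_cont f b that \<mu>'])
  show ?thesis
    unfolding relaxed_equilibrium_def
  proof (intro exI[of _ \<mu>] conjI ballI allI \<mu>')
    fix \<pi>' :: "'s \<Rightarrow> (real ^ 'l) measure" and i
    assume \<pi>': "\<pi>' \<in> relaxed_controls U"
    then have \<pi>'_i: "\<pi>' i \<in> space (prob_algebra (restrict_space borel U))"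
      by (simp add: relaxed_controls_def)
    note int = integrable_continuous_compact[OF U(1) \<pi>'_i]
    interpret prob_space "\<pi>' i"
      by (rule space_prob_algebra_restrict_borel[OF \<pi>'_i])
    \<comment> \<open>The value of a deviation is the mean under \<open>\<pi>' i\<close> of the
      payoffs of single actions.\<close>
    have "control_value p f (\<pi>' \<otimes>\<^sub>1 \<mu>) i = (LINT u|\<pi>' i. f 0 i u + (\<Sum>j\<in>UNIV. p u $ i $ j * W j))"
      unfolding value_eq[OF \<pi>'] q_def by (simp add: int f0_cont p_cont)
    also have "\<dots> \<le> R i"
      using R_U by (intro integral_le_const int Q_cont AE_I2)
        (simp add: space_prob_algebra_restrict_borel[OF \<pi>'_i])
    \<comment> \<open>Following \<open>\<mu>\<close> throughout is the trivial deviation, so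
      \<open>R i\<close> is its value.\<close>
    also have "R i = control_value p f (\<mu> \<otimes>\<^sub>1 \<mu>) i"
      unfolding value_eq[OF \<mu>'] R_def ..
    also have "\<mu> \<otimes>\<^sub>1 \<mu> = (\<lambda>_. \<mu>)"
      by (simp add: concat1_def fun_eq_iff)
    finally show "control_value p f (\<pi>' \<otimes>\<^sub>1 \<mu>) i \<le> control_value p f (\<lambda>_. \<mu>) i" .
  qed
qed

section \<open>Domination and continuity from the stated hypotheses\<close>

theorem theorem2p2:
  fixes U :: "(real ^ 'l::finite) set"
    and p :: "real ^ 'l \<Rightarrow> real ^ 's ^ 's::finite"
    and f :: "real \<Rightarrow> 's \<Rightarrow> real ^ 'l \<Rightarrow> real"
    and \<delta> :: "real \<Rightarrow> real"
  assumes compact_U: "compact U"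
    and Leb_U: "emeasure lebesgue U > 0"
    and stochastic: "\<And>u. u \<in> U \<Longrightarrow> stochastic_matrix (p u)"
    and delta_range: "\<And>t. t \<ge> 0 \<Longrightarrow> \<delta> t \<in> {0..1}"
    and delta_nonincreasing: "\<And>s t. 0 \<le> s \<Longrightarrow> s \<le> t \<Longrightarrow> \<delta> t \<le> \<delta> s"
    and delta_0: "\<delta> 0 = 1"
    and M_finite:
      "(\<Sum>t::nat. (SUP i. SUP u\<in>U. ennreal \<bar>f (real t) i u\<bar>) + ennreal (\<delta> (real t))) < \<infinity>"
    and Theta_finite:
      "(SUP t::nat. SUP i. SUP (u1, u2)\<in>{(u1, u2). u1 \<in> U \<and> u2 \<in> U \<and> u1 \<noteq> u2}.
          ennreal (\<bar>f (real t) i u1 - f (real t) i u2\<bar> / norm (u1 - u2)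
            + norm (p u1 $ i - p u2 $ i) / norm (u1 - u2))) < \<infinity>"
    and cone: "uniform_cone_condition U"
  shows "\<exists>\<pi>. relaxed_equilibrium U p f \<pi>"
proof -
  \<comment> \<open>The series of supremal rewards is dominated by the one in
    \<open>M_finite\<close>; its sum being finite, every term is finite and the real counterparts
    are summable.\<close>
  define B where "B t = (SUP i. SUP u\<in>U. ennreal \<bar>f (real t) i u\<bar>)" for t
  have "(\<Sum>t. B t) \<le> (\<Sum>t. B t + ennreal (\<delta> (real t)))"
    by (intro suminf_le) auto
  with M_finite have B_sum: "(\<Sum>t. B t) < \<infinity>"
    unfolding B_def by (rule le_less_trans[rotated])
  have B_fin: "B t < \<infinity>" for t
    using sum_le_suminf[of B "{t}"] B_sum by (auto simp: less_top[symmetric] top_unique)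
  have f: "\<bar>f (real t) i u\<bar> \<le> enn2real (B t)" if "u \<in> U" for t i u
  proof -
    have "ennreal \<bar>f (real t) i u\<bar> \<le> B t"
      unfolding B_def using that by (intro SUP_upper2[of i] SUP_upper2[of u]) auto
    then show ?thesis
      using B_fin[of t] by (metis abs_ge_zero enn2real_ennreal enn2real_mono infinity_ennreal_def)
  qed
  have "summable (\<lambda>t. enn2real (B t))"
    using B_sum B_fin by (intro summable_suminf_not_top) (auto simp: less_top[symmetric])
  define \<Theta> where "\<Theta> = (SUP t::nat. SUP i. SUP (u1, u2)\<in>{(u1, u2). u1 \<in> U \<and> u2 \<in> U \<and> u1 \<noteq> u2}.
          ennreal (\<bar>f (real t) i u1 - f (real t) i u2\<bar> / norm (u1 - u2)
            + norm (p u1 $ i - p u2 $ i) / norm (u1 - u2)))"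
  have quot: "\<bar>f (real t) i u1 - f (real t) i u2\<bar> / norm (u1 - u2)
            + norm (p u1 $ i - p u2 $ i) / norm (u1 - u2) \<le> enn2real \<Theta>"
    if "u1 \<in> U" "u2 \<in> U" "u1 \<noteq> u2" for t i u1 u2
  proof -
    have "ennreal (\<bar>f (real t) i u1 - f (real t) i u2\<bar> / norm (u1 - u2)
            + norm (p u1 $ i - p u2 $ i) / norm (u1 - u2)) \<le> \<Theta>"
      unfolding \<Theta>_def using that by (intro SUP_upper2[of t] SUP_upper2[of i] SUP_upper2[of "(u1, u2)"]) auto
    then have "enn2real (ennreal (\<bar>f (real t) i u1 - f (real t) i u2\<bar> / norm (u1 - u2)
            + norm (p u1 $ i - p u2 $ i) / norm (u1 - u2))) \<le> enn2real \<Theta>"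
      using Theta_finite unfolding \<Theta>_def[symmetric] by (intro enn2real_mono) auto
    then show ?thesis
      by (subst (asm) enn2real_ennreal) auto
  qed
  \<comment> \<open>Clearing the denominator gives a joint bound that also covers equal points. As
    both summands are nonnegative, rewards and transition rows are each Lipschitz with constant
    \<open>enn2real \<Theta>\<close>.\<close>
  have lip: "\<bar>f (real t) i u1 - f (real t) i u2\<bar> + norm (p u1 $ i - p u2 $ i) \<le> enn2real \<Theta> * norm (u1 - u2)"
    if "u1 \<in> U" "u2 \<in> U" for t i u1 u2
    using quot[OF that, of t i] by (cases "u1 = u2") (auto simp: field_simps)
  have "(enn2real \<Theta>)-lipschitz_on U (f (real t) i)" for t i
  proof (rule lipschitz_onI)
    show "dist (f (real t) i x) (f (real t) i y) \<le> enn2real \<Theta> * dist x y" if "x \<in> U" "y \<in> U" for x y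
      unfolding dist_norm real_norm_def using lip[OF that, of t i] norm_ge_zero[of "p x $ i - p y $ i"] by linarith
  qed simp
  then have "continuous_on U (f (real t) i)" for t i
    by (rule lipschitz_on_continuous_on)
  moreover have "(enn2real \<Theta>)-lipschitz_on U (\<lambda>u. p u $ i)" for i
  proof (rule lipschitz_onI)
    show "dist (p x $ i) (p y $ i) \<le> enn2real \<Theta> * dist x y" if "x \<in> U" "y \<in> U" for x y
      unfolding dist_norm using lip[OF that, of 0 i] by linarith
  qed simp
  then have "continuous_on U (\<lambda>u. p u $ i $ j)" for i j
    by (intro continuous_on_component lipschitz_on_continuous_on)
  moreover have "U \<noteq> {}"
    using Leb_U by auto
  ultimately show ?thesis
    using \<open>summable (\<lambda>t. enn2real (B t))\<close> stochastic f
    by (intro relaxed_equilibrium_exists[where b = "\<lambda>t. enn2real (B t)"] compact_U)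
qed

end
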